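(* Let $(\mathcal B,\otimes,\mathbb 1)$ be a braided monoidal category with braiding $c$, let $H$ be a Hopf algebra in $\mathcal B$, and let $(\delta,\sigma)$ be a modular pair for $H$. Then: (1) For all $n\ge 2$ and $2\le k\le n$, $$(\tau_n(\delta,\sigma))^k=\bigl(\mathrm{id}_{H^{\otimes n-k}}\otimes R_\sigma^{\otimes k-1}\otimes \mathrm{id}_H\bigr)\circ\bigl((\tau_{n-1}(\varepsilon,u))^{k-1}\otimes\tau_1(\delta,\sigma)\bigr)\circ c_{H,H^{\otimes n-1}}\circ\bigl(c_{H^{\otimes k-2},H}\otimes \mathrm{id}_{H^{\otimes n-k+1}}\bigr)\circ\bigl(\varphi_\delta^{\otimes k-2}\otimes m(\tilde S\otimes \mathrm{id}_H)\otimes \mathrm{id}_{H^{\otimes n-k+1}}\bigr)\circ\bigl(\mathrm{id}_{H^{\otimes k-1}}\otimes\Delta\otimes \mathrm{id}_{H^{\otimes n-k}}\bigr).$$ (2) For $n=1$, $$(\tau_1(\delta,\sigma))^2=\mathrm{ad}_\sigma\circ S^2\circ\varphi_\delta,$$ and for all $n\ge2$, $$(\tau_n(\delta,\sigma))^{n+1}=\Bigl(\bigl(\mathrm{ad}_\sigma^{\otimes n-1}\circ(\tau_{n-1}(\varepsilon,u))^{n}\circ\varphi_\delta^{\otimes n-1}\bigr)\otimes(\tau_1(\delta,\sigma))^2\Bigr)\circ c_{H,H^{\otimes n-1}}\circ c_{H^{\otimes n-1},H}.$$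
   Context: Associativity and unit constraints are suppressed; $H^{\otimes 0}=\mathbb 1$ and $f^{\otimes 0}=\mathrm{id}_{\mathbb 1}$. The braiding $c=\{c_{X,Y}\colon X\otimes Y\to Y\otimes X\}$ is a family of natural isomorphisms with $c_{X,Y\otimes Z}=(\mathrm{id}_Y\otimes c_{X,Z})(c_{X,Y}\otimes\mathrm{id}_Z)$ and $c_{X\otimes Y,Z}=(c_{X,Z}\otimes\mathrm{id}_Y)(\mathrm{id}_X\otimes c_{Y,Z})$. A Hopf algebra in $\mathcal B$ is $(H,m,u,\Delta,\varepsilon,S)$ where $(H,m,u)$ is an (associative unital) algebra in $\mathcal B$, $(H,\Delta,\varepsilon)$ is a (coassociative counital) coalgebra in $\mathcal B$, $\Delta m=(m\otimes m)(\mathrm{id}_H\otimes c_{H,H}\otimes\mathrm{id}_H)(\Delta\otimes\Delta)$, $\Delta u=u\otimes u$, $\varepsilon m=\varepsilon\otimes\varepsilon$, $\varepsilon u=\mathrm{id}_{\mathbb 1}$, and $S\colon H\to H$ is an isomorphism with $m(S\otimes\mathrm{id}_H)\Delta=u\varepsilon=m(\mathrm{id}_H\otimes S)\Delta$. A modular pair for $H$ is a pair $(\delta,\sigma)$ with $\delta\colon H\to\mathbb 1$ an algebra morphism and $\sigma\colon\mathbb 1\to H$ a coalgebra morphism such that $\delta\sigma=\mathrm{id}_{\mathbb 1}$. In particular $(\varepsilon,u)$ is a modular pair. The left diagonal action $\lambda_n\colon H\otimes H^{\otimes n}\to H^{\otimes n}$ is defined by $\lambda_0=\varepsilon$ and $\lambda_n=(m\otimes\lambda_{n-1})(\mathrm{id}_H\otimes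 c_{H,H}\otimes\mathrm{id}_{H^{\otimes n-1}})(\Delta\otimes\mathrm{id}_{H^{\otimes n}})$ for $n\ge1$ (so $\lambda_1=m$). Given a modular pair $(\delta,\sigma)$, set: - twisted antipode $\tilde S=(\delta\otimes S)\Delta\colon H\to H$; - $\tau_0(\delta,\sigma)=\mathrm{id}_{\mathbb 1}$ and $\tau_n(\delta,\sigma)=\lambda_n(\tilde S\otimes\mathrm{id}_{H^{\otimes n-1}}\otimes\sigma)\colon H^{\otimes n}\to H^{\otimes n}$ for $n\ge1$; $\tau_n(\varepsilon,u)$ is the same operator for the modular pair $(\varepsilon,u)$ (whose twisted antipode is $S$); - $R_\sigma=m(\mathrm{id}_H\otimes\sigma)\colon H\to H$ ($R_\sigma^{\otimes n}$ is the right diagonal action of $\sigma$ on $H^{\otimes n}$); - $\varphi_\delta=(\delta\otimes\mathrm{id}_H\otimes\delta S)(\Delta\otimes\mathrm{id}_H)\Delta\colon H\to H$ ($\varphi_\delta^{\otimes n}$ is the left coadjoint coaction of $H$ on $H^{\otimes n}$ followed by $\delta$ on the coacting factor); - $\mathrm{ad}_\sigma=m(m\otimes\mathrm{id}_H)(S\sigma\otimes\mathrm{id}_H\otimes\sigma)\colon H\to H$ ($\mathrm{ad}_\sigma^{\otimes n}$ is the right adjoint action of $\sigma$ on $H^{\otimes n}$). *)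

theory Defs
  imports Main
begin

section \<open>Braided monoidal categories\<close>

text \<open>
  The associativity and unit constraints are part of the data and are not assumed to be
  identities.  Arrows compose as functions do: \<open>g \<cdot> f\<close> is \<open>g\<close> after \<open>f\<close>.
\<close>

record ('o, 'a) category_data =
  obj :: "'o set"
  arr :: "'a set"
  src :: "'a \<Rightarrow> 'o"
  trg :: "'a \<Rightarrow> 'o"
  ident :: "'o \<Rightarrow> 'a"
  cmp :: "'a \<Rightarrow> 'a \<Rightarrow> 'a"  (infixr "\<cdot>\<index>" 55)

record ('o, 'a) monoidal_data = "('o, 'a) category_data" +
  tens_obj :: "'o \<Rightarrow> 'o \<Rightarrow> 'o"  (infixr "\<odot>\<index>" 70)
  tens_arr :: "'a \<Rightarrow> 'a \<Rightarrow> 'a"  (infixr "\<otimes>\<index>" 70)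
  unit_obj :: "'o"  ("\<one>\<index>")
  asc :: "'o \<Rightarrow> 'o \<Rightarrow> 'o \<Rightarrow> 'a"
  lunit :: "'o \<Rightarrow> 'a"
  runit :: "'o \<Rightarrow> 'a"

record ('o, 'a) braided_data = "('o, 'a) monoidal_data" +
  braid :: "'o \<Rightarrow> 'o \<Rightarrow> 'a"

definition hom :: "('o, 'a, 'm) category_data_scheme \<Rightarrow> 'o \<Rightarrow> 'o \<Rightarrow> 'a set" where
  "hom C X Y = {f \<in> arr C. src C f = X \<and> trg C f = Y}"

definition inverse_arrows :: "('o, 'a, 'm) category_data_scheme \<Rightarrow> 'a \<Rightarrow> 'a \<Rightarrow> bool" where
  "inverse_arrows C f g \<longleftrightarrow>
     f \<in> arr C \<and> g \<in> hom C (trg C f) (src C f) \<and>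
     cmp C g f = ident C (src C f) \<and> cmp C f g = ident C (trg C f)"

definition iso_arr :: "('o, 'a, 'm) category_data_scheme \<Rightarrow> 'a \<Rightarrow> bool" where
  "iso_arr C f \<longleftrightarrow> (\<exists>g. inverse_arrows C f g)"

definition arr_inv :: "('o, 'a, 'm) category_data_scheme \<Rightarrow> 'a \<Rightarrow> 'a" where
  "arr_inv C f = (THE g. inverse_arrows C f g)"

locale category =
  fixes B :: "('o, 'a, 'm) category_data_scheme" (structure)
  assumes src_obj: "f \<in> arr B \<Longrightarrow> src B f \<in> obj B"
    and trg_obj: "f \<in> arr B \<Longrightarrow> trg B f \<in> obj B"
    and ident_hom: "X \<in> obj B \<Longrightarrow> ident B X \<in> hom B X X"
    and cmp_hom: "\<lbrakk>f \<in> hom B X Y; g \<in> hom B Y Z\<rbrakk> \<Longrightarrow> g \<cdot> f \<in> hom B X Z"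
    and cmp_assoc:
      "\<lbrakk>f \<in> hom B W X; g \<in> hom B X Y; h \<in> hom B Y Z\<rbrakk> \<Longrightarrow> (h \<cdot> g) \<cdot> f = h \<cdot> (g \<cdot> f)"
    and ident_left: "f \<in> hom B X Y \<Longrightarrow> ident B Y \<cdot> f = f"
    and ident_right: "f \<in> hom B X Y \<Longrightarrow> f \<cdot> ident B X = f"

locale monoidal_category = category B
  for B :: "('o, 'a, 'm) monoidal_data_scheme" (structure) +
  assumes unit_obj: "\<one> \<in> obj B"
    and tens_obj: "\<lbrakk>X \<in> obj B; Y \<in> obj B\<rbrakk> \<Longrightarrow> X \<odot> Y \<in> obj B"
    and tens_hom:
      "\<lbrakk>f \<in> hom B X Y; g \<in> hom B X' Y'\<rbrakk> \<Longrightarrow> f \<otimes> g \<in> hom B (X \<odot> X') (Y \<odot> Y')"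
    and tens_ident:
      "\<lbrakk>X \<in> obj B; Y \<in> obj B\<rbrakk> \<Longrightarrow> ident B X \<otimes> ident B Y = ident B (X \<odot> Y)"
    and tens_cmp:
      "\<lbrakk>f \<in> hom B X Y; g \<in> hom B Y Z; f' \<in> hom B X' Y'; g' \<in> hom B Y' Z'\<rbrakk>
        \<Longrightarrow> (g \<cdot> f) \<otimes> (g' \<cdot> f') = (g \<otimes> g') \<cdot> (f \<otimes> f')"
    and asc_hom:
      "\<lbrakk>X \<in> obj B; Y \<in> obj B; Z \<in> obj B\<rbrakk>
        \<Longrightarrow> asc B X Y Z \<in> hom B ((X \<odot> Y) \<odot> Z) (X \<odot> (Y \<odot> Z))"
    and asc_iso: "\<lbrakk>X \<in> obj B; Y \<in> obj B; Z \<in> obj B\<rbrakk> \<Longrightarrow> iso_arr B (asc B X Y Z)"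
    and asc_natural:
      "\<lbrakk>f \<in> hom B X X'; g \<in> hom B Y Y'; h \<in> hom B Z Z'\<rbrakk>
        \<Longrightarrow> asc B X' Y' Z' \<cdot> ((f \<otimes> g) \<otimes> h) = (f \<otimes> (g \<otimes> h)) \<cdot> asc B X Y Z"
    and lunit_hom: "X \<in> obj B \<Longrightarrow> lunit B X \<in> hom B (\<one> \<odot> X) X"
    and lunit_iso: "X \<in> obj B \<Longrightarrow> iso_arr B (lunit B X)"
    and lunit_natural:
      "f \<in> hom B X Y \<Longrightarrow> lunit B Y \<cdot> (ident B \<one> \<otimes> f) = f \<cdot> lunit B X"
    and runit_hom: "X \<in> obj B \<Longrightarrow> runit B X \<in> hom B (X \<odot> \<one>) X"
    and runit_iso: "X \<in> obj B \<Longrightarrow> iso_arr B (runit B X)"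
    and runit_natural:
      "f \<in> hom B X Y \<Longrightarrow> runit B Y \<cdot> (f \<otimes> ident B \<one>) = f \<cdot> runit B X"
    and pentagon:
      "\<lbrakk>W \<in> obj B; X \<in> obj B; Y \<in> obj B; Z \<in> obj B\<rbrakk>
        \<Longrightarrow> (ident B W \<otimes> asc B X Y Z) \<cdot> asc B W (X \<odot> Y) Z \<cdot> (asc B W X Y \<otimes> ident B Z)
            = asc B W X (Y \<odot> Z) \<cdot> asc B (W \<odot> X) Y Z"
    and triangle:
      "\<lbrakk>X \<in> obj B; Y \<in> obj B\<rbrakk>
        \<Longrightarrow> (ident B X \<otimes> lunit B Y) \<cdot> asc B X \<one> Y = runit B X \<otimes> ident B Y"

locale braided_monoidal_category = monoidal_category B
  for B :: "('o, 'a, 'm) braided_data_scheme" (structure) +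
  assumes braid_hom:
      "\<lbrakk>X \<in> obj B; Y \<in> obj B\<rbrakk> \<Longrightarrow> braid B X Y \<in> hom B (X \<odot> Y) (Y \<odot> X)"
    and braid_iso: "\<lbrakk>X \<in> obj B; Y \<in> obj B\<rbrakk> \<Longrightarrow> iso_arr B (braid B X Y)"
    and braid_natural:
      "\<lbrakk>f \<in> hom B X X'; g \<in> hom B Y Y'\<rbrakk>
        \<Longrightarrow> braid B X' Y' \<cdot> (f \<otimes> g) = (g \<otimes> f) \<cdot> braid B X Y"
    and hexagon_right:
      "\<lbrakk>X \<in> obj B; Y \<in> obj B; Z \<in> obj B\<rbrakk>
        \<Longrightarrow> asc B Y Z X \<cdot> braid B X (Y \<odot> Z) \<cdot> asc B X Y Z
            = (ident B Y \<otimes> braid B X Z) \<cdot> asc B Y X Z \<cdot> (braid B X Y \<otimes> ident B Z)"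
    and hexagon_left:
      "\<lbrakk>X \<in> obj B; Y \<in> obj B; Z \<in> obj B\<rbrakk>
        \<Longrightarrow> arr_inv B (asc B Z X Y) \<cdot> braid B (X \<odot> Y) Z \<cdot> arr_inv B (asc B X Y Z)
            = (braid B X Z \<otimes> ident B Y) \<cdot> arr_inv B (asc B X Z Y) \<cdot> (ident B X \<otimes> braid B Y Z)"


section \<open>Suppressing the constraints\<close>

text \<open>
  Formulas with suppressed constraints are read in the usual strictification of \<open>B\<close>.
  A word \<open>[X\<^sub>1, \<dots>, X\<^sub>n]\<close> of objects stands for \<open>X\<^sub>1 \<odot> (X\<^sub>2 \<odot> (\<dots> \<odot> X\<^sub>n))\<close>, so
  that \<open>[]\<close> stands for the unit object, \<open>[X]\<close> for \<open>X\<close> and \<open>[X, Y]\<close> for \<open>X \<odot> Y\<close>.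
  A word arrow from \<open>xs\<close> to \<open>ys\<close> is just an arrow of \<open>B\<close> between the objects
  these words stand for, tagged with the words.  Tensoring concatenates words; the canonical
  isomorphism \<open>merge B xs ys\<close> from \<open>word_obj B xs \<odot> word_obj B ys\<close> to
  \<open>word_obj B (xs @ ys)\<close>, composed of associativity and unit constraints, makes the
  sources and targets fit.  If \<open>B\<close> is strict, then \<open>merge B xs ys\<close> is an identity.
\<close>

fun word_obj :: "('o, 'a, 'm) monoidal_data_scheme \<Rightarrow> 'o list \<Rightarrow> 'o" where
  "word_obj B [] = unit_obj B"
| "word_obj B [X] = X"
| "word_obj B (X # Y # ys) = tens_obj B X (word_obj B (Y # ys))"

fun merge :: "('o, 'a, 'm) monoidal_data_scheme \<Rightarrow> 'o list \<Rightarrow> 'o list \<Rightarrow> 'a" where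
  "merge B [] ys = lunit B (word_obj B ys)"
| "merge B [X] [] = runit B X"
| "merge B [X] (Y # ys) = ident B (tens_obj B X (word_obj B (Y # ys)))"
| "merge B (X # X' # xs) ys =
     cmp B (tens_arr B (ident B X) (merge B (X' # xs) ys))
       (asc B X (word_obj B (X' # xs)) (word_obj B ys))"

datatype ('o, 'a) word_arr = Word_Arr (wsrc: "'o list") (und: 'a) (wtrg: "'o list")

definition word_hom ::
  "('o, 'a, 'm) monoidal_data_scheme \<Rightarrow> 'o list \<Rightarrow> 'o list \<Rightarrow> ('o, 'a) word_arr set" where
  "word_hom B xs ys =
     {Word_Arr xs f ys | f.
        set xs \<subseteq> obj B \<and> set ys \<subseteq> obj B \<and> f \<in> hom B (word_obj B xs) (word_obj B ys)}"

definition wid :: "('o, 'a, 'm) monoidal_data_scheme \<Rightarrow> 'o list \<Rightarrow> ('o, 'a) word_arr" where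
  "wid B xs = Word_Arr xs (ident B (word_obj B xs)) xs"

definition wcmp ::
  "('o, 'a, 'm) monoidal_data_scheme \<Rightarrow> ('o, 'a) word_arr \<Rightarrow> ('o, 'a) word_arr \<Rightarrow> ('o, 'a) word_arr"
  (infixr "\<bullet>\<index>" 55) where
  "wcmp B g f = Word_Arr (wsrc f) (cmp B (und g) (und f)) (wtrg g)"

definition wtens ::
  "('o, 'a, 'm) monoidal_data_scheme \<Rightarrow> ('o, 'a) word_arr \<Rightarrow> ('o, 'a) word_arr \<Rightarrow> ('o, 'a) word_arr"
  (infixr "\<boxtimes>\<index>" 70) where
  "wtens B f g =
     Word_Arr (wsrc f @ wsrc g)
       (cmp B (merge B (wtrg f) (wtrg g))
         (cmp B (tens_arr B (und f) (und g)) (arr_inv B (merge B (wsrc f) (wsrc g)))))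
       (wtrg f @ wtrg g)"

definition wbraid ::
  "('o, 'a, 'm) braided_data_scheme \<Rightarrow> 'o list \<Rightarrow> 'o list \<Rightarrow> ('o, 'a) word_arr" where
  "wbraid B xs ys =
     Word_Arr (xs @ ys)
       (cmp B (merge B ys xs)
         (cmp B (braid B (word_obj B xs) (word_obj B ys)) (arr_inv B (merge B xs ys))))
       (ys @ xs)"

primrec wpow ::
  "('o, 'a, 'm) monoidal_data_scheme \<Rightarrow> ('o, 'a) word_arr \<Rightarrow> nat \<Rightarrow> ('o, 'a) word_arr" where
  "wpow B f 0 = wid B (wsrc f)"
| "wpow B f (Suc n) = wcmp B f (wpow B f n)"

primrec wtpow ::
  "('o, 'a, 'm) monoidal_data_scheme \<Rightarrow> ('o, 'a) word_arr \<Rightarrow> nat \<Rightarrow> ('o, 'a) word_arr" where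
  "wtpow B f 0 = wid B []"
| "wtpow B f (Suc n) = wtens B f (wtpow B f n)"


section \<open>Hopf algebras and modular pairs\<close>

record ('o, 'a) hopf_data =
  base :: "'o"
  mul :: "('o, 'a) word_arr"
  unt :: "('o, 'a) word_arr"
  comul :: "('o, 'a) word_arr"
  cnt :: "('o, 'a) word_arr"
  ant :: "('o, 'a) word_arr"

text \<open>\<open>hpow H n\<close> is the word for the \<open>n\<close>-th tensor power of the underlying object.\<close>

abbreviation hpow :: "('o, 'a) hopf_data \<Rightarrow> nat \<Rightarrow> 'o list" where
  "hpow H n \<equiv> replicate n (base H)"

abbreviation hid :: "('o, 'a, 'm) monoidal_data_scheme \<Rightarrow> ('o, 'a) hopf_data \<Rightarrow> nat \<Rightarrow> ('o, 'a) word_arr" where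
  "hid B H n \<equiv> wid B (hpow H n)"

definition algebra_in :: "('o, 'a, 'm) monoidal_data_scheme \<Rightarrow>
    'o \<Rightarrow> ('o, 'a) word_arr \<Rightarrow> ('o, 'a) word_arr \<Rightarrow> bool" where
  "algebra_in B X m u \<longleftrightarrow>
     X \<in> obj B \<and> m \<in> word_hom B [X, X] [X] \<and> u \<in> word_hom B [] [X] \<and>
     m \<bullet> (m \<boxtimes> wid B [X]) = m \<bullet> (wid B [X] \<boxtimes> m) \<and>
     m \<bullet> (u \<boxtimes> wid B [X]) = wid B [X] \<and>
     m \<bullet> (wid B [X] \<boxtimes> u) = wid B [X]"
  for B (structure)

definition coalgebra_in :: "('o, 'a, 'm) monoidal_data_scheme \<Rightarrow>
    'o \<Rightarrow> ('o, 'a) word_arr \<Rightarrow> ('o, 'a) word_arr \<Rightarrow> bool" where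
  "coalgebra_in B X d e \<longleftrightarrow>
     X \<in> obj B \<and> d \<in> word_hom B [X] [X, X] \<and> e \<in> word_hom B [X] [] \<and>
     (d \<boxtimes> wid B [X]) \<bullet> d = (wid B [X] \<boxtimes> d) \<bullet> d \<and>
     (e \<boxtimes> wid B [X]) \<bullet> d = wid B [X] \<and>
     (wid B [X] \<boxtimes> e) \<bullet> d = wid B [X]"
  for B (structure)

definition hopf_algebra_in :: "('o, 'a, 'm) braided_data_scheme \<Rightarrow> ('o, 'a) hopf_data \<Rightarrow> bool" where
  "hopf_algebra_in B H \<longleftrightarrow>
     algebra_in B (base H) (mul H) (unt H) \<and>
     coalgebra_in B (base H) (comul H) (cnt H) \<and>
     comul H \<bullet> mul H =
       (mul H \<boxtimes> mul H) \<bullet> (hid B H 1 \<boxtimes> wbraid B (hpow H 1) (hpow H 1) \<boxtimes> hid B H 1)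
         \<bullet> (comul H \<boxtimes> comul H) \<and>
     comul H \<bullet> unt H = unt H \<boxtimes> unt H \<and>
     cnt H \<bullet> mul H = cnt H \<boxtimes> cnt H \<and>
     cnt H \<bullet> unt H = wid B [] \<and>
     ant H \<in> word_hom B (hpow H 1) (hpow H 1) \<and> iso_arr B (und (ant H)) \<and>
     mul H \<bullet> (ant H \<boxtimes> hid B H 1) \<bullet> comul H = unt H \<bullet> cnt H \<and>
     mul H \<bullet> (hid B H 1 \<boxtimes> ant H) \<bullet> comul H = unt H \<bullet> cnt H"
  for B (structure)

text \<open>
  The unit object carries its trivial algebra and coalgebra structures, whose structure arrows
  are unit constraints and hence invisible here.
\<close>

definition modular_pair :: "('o, 'a, 'm) monoidal_data_scheme \<Rightarrow> ('o, 'a) hopf_data \<Rightarrow>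
    ('o, 'a) word_arr \<Rightarrow> ('o, 'a) word_arr \<Rightarrow> bool" where
  "modular_pair B H \<delta> \<sigma> \<longleftrightarrow>
     \<delta> \<in> word_hom B (hpow H 1) [] \<and> \<delta> \<bullet> mul H = \<delta> \<boxtimes> \<delta> \<and> \<delta> \<bullet> unt H = wid B [] \<and>
     \<sigma> \<in> word_hom B [] (hpow H 1) \<and> comul H \<bullet> \<sigma> = \<sigma> \<boxtimes> \<sigma> \<and> cnt H \<bullet> \<sigma> = wid B [] \<and>
     \<delta> \<bullet> \<sigma> = wid B []"
  for B (structure)


section \<open>The operators\<close>

primrec diag_action ::
  "('o, 'a, 'm) braided_data_scheme \<Rightarrow> ('o, 'a) hopf_data \<Rightarrow> nat \<Rightarrow> ('o, 'a) word_arr" where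
  "diag_action B H 0 = cnt H"
| "diag_action B H (Suc n) =
     (mul H \<boxtimes>\<^bsub>B\<^esub> diag_action B H n)
       \<bullet>\<^bsub>B\<^esub> (hid B H 1 \<boxtimes>\<^bsub>B\<^esub> wbraid B (hpow H 1) (hpow H 1) \<boxtimes>\<^bsub>B\<^esub> hid B H n)
       \<bullet>\<^bsub>B\<^esub> (comul H \<boxtimes>\<^bsub>B\<^esub> hid B H (Suc n))"

definition twisted_antipode :: "('o, 'a, 'm) monoidal_data_scheme \<Rightarrow> ('o, 'a) hopf_data \<Rightarrow>
    ('o, 'a) word_arr \<Rightarrow> ('o, 'a) word_arr" where
  "twisted_antipode B H \<delta> = (\<delta> \<boxtimes> ant H) \<bullet> comul H"
  for B (structure)

definition tau :: "('o, 'a, 'm) braided_data_scheme \<Rightarrow> ('o, 'a) hopf_data \<Rightarrow>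
    ('o, 'a) word_arr \<Rightarrow> ('o, 'a) word_arr \<Rightarrow> nat \<Rightarrow> ('o, 'a) word_arr" where
  "tau B H \<delta> \<sigma> n =
     (if n = 0 then wid B []
      else diag_action B H n \<bullet> (twisted_antipode B H \<delta> \<boxtimes> hid B H (n - 1) \<boxtimes> \<sigma>))"
  for B (structure)

definition R_op :: "('o, 'a, 'm) monoidal_data_scheme \<Rightarrow> ('o, 'a) hopf_data \<Rightarrow>
    ('o, 'a) word_arr \<Rightarrow> ('o, 'a) word_arr" where
  "R_op B H \<sigma> = mul H \<bullet> (hid B H 1 \<boxtimes> \<sigma>)"
  for B (structure)

definition phi_op :: "('o, 'a, 'm) monoidal_data_scheme \<Rightarrow> ('o, 'a) hopf_data \<Rightarrow>
    ('o, 'a) word_arr \<Rightarrow> ('o, 'a) word_arr" where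
  "phi_op B H \<delta> =
     (\<delta> \<boxtimes> hid B H 1 \<boxtimes> (\<delta> \<bullet> ant H)) \<bullet> (comul H \<boxtimes> hid B H 1) \<bullet> comul H"
  for B (structure)

definition ad_op :: "('o, 'a, 'm) monoidal_data_scheme \<Rightarrow> ('o, 'a) hopf_data \<Rightarrow>
    ('o, 'a) word_arr \<Rightarrow> ('o, 'a) word_arr" where
  "ad_op B H \<sigma> =
     mul H \<bullet> (mul H \<boxtimes> hid B H 1) \<bullet> ((ant H \<bullet> \<sigma>) \<boxtimes> hid B H 1 \<boxtimes> \<sigma>)"
  for B (structure)

end

(*
  Every formula is an equation between words in the generators m, Delta, u, epsilon, S, c, delta,
  sigma, each acting at some position of a tensor power of H. In the strictification, arrows that
  differ by tensoring with identities on the right act in the same way, and since epsilon u = id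
  no information is lost by identifying them. All words then compose without typing conditions and
  can be rewritten freely.

  Write q for n - 1 and lambda for the diagonal action. Splitting off the last factor in tau_n
  and cancelling S(h_1 a) h_2 = epsilon(h) S(a) yields the case k = 2:
  tau_n^2 = R_sigma tau_q(epsilon,u) tau_1 F, with R_sigma on the last factor of H^q and tau_1 on the
  remaining factor. Pulling a further tau_n through F uses the key relation
  S~(h_1 a) (h_2 b)_1 (x) (h_2 b)_2 = delta(h_1) S~(a) b_1 (x) h_2 b_2, and turns F into the
  analogous word with one more phi_delta, at the price of another factor R_sigma tau_q(epsilon,u).
  As tau_q(epsilon,u) moves R_sigma one factor to the left, the R_sigma accumulate on adjacent
  factors. After n + 1 steps R_sigma reaches the first factor, where tau_q(epsilon,u) converts it
  into the diagonal left multiplication by S sigma; with the R_sigma^q already present this is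
  ad_sigma^q.
*)
theory Submission
  imports Defs
begin

section \<open>Strictification\<close>

text \<open>The shape of the powers is governed by the scalar delta(h1) that the key relation leaves
  behind. It is kept as \<open>pl\<close>, the coaction h \<mapsto> delta(h1) h2 on the acting
  element h. To get out, it has to pass the copies of phi left on the leading factors by earlier
  steps; this works because phi is multiplicative and phi(h1) \<otimes> pl(h2) is the coproduct of
  pl(h). Now h is itself a value of S~, and S turns a right coaction by delta S into a left coaction
  by delta, so the scalar ends as one more phi under a plain S. This accounts for the exponent of
  phi and for the plain S in the operators that the induction adds. The braiding need not be a
  symmetry, so factors are never silently reordered: each crossing is an operator of its own, to be
  absorbed by a bialgebra law or undone by naturality when one of its strands starts in u or sigma
  or ends in epsilon or delta.\<close>

context category
begin

abbreviation "ar \<equiv> arr B"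
abbreviation "sr \<equiv> src B"
abbreviation "tg \<equiv> trg B"
abbreviation "ide \<equiv> ident B"
abbreviation "ainv \<equiv> arr_inv B"

lemma hom_iff: "f \<in> hom B X Y \<longleftrightarrow> f \<in> ar \<and> sr f = X \<and> tg f = Y"
  by (auto simp: hom_def)

lemma ide_typed [simp]: "X \<in> obj B \<Longrightarrow> ide X \<in> ar" "X \<in> obj B \<Longrightarrow> sr (ide X) = X"
  "X \<in> obj B \<Longrightarrow> tg (ide X) = X"
  using ident_hom by (auto simp: hom_iff)

lemma cmp_typed [simp]:
  assumes "f \<in> ar" "g \<in> ar" "tg f = sr g"
  shows "g \<cdot> f \<in> ar" "sr (g \<cdot> f) = sr f" "tg (g \<cdot> f) = tg g"
  using cmp_hom[of f "sr f" "tg f" g "tg g"] assms by (auto simp: hom_iff)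

declare src_obj [simp] trg_obj [simp]

lemma cmp_assoc': "\<lbrakk>f \<in> ar; g \<in> ar; h \<in> ar; tg f = sr g; tg g = sr h\<rbrakk> \<Longrightarrow> (h \<cdot> g) \<cdot> f = h \<cdot> g \<cdot> f"
  using cmp_assoc[of f "sr f" "tg f" g "tg g" h "tg h"] by (simp add: hom_iff)

lemma ide_left [simp]: "\<lbrakk>f \<in> ar; tg f = Y\<rbrakk> \<Longrightarrow> ide Y \<cdot> f = f"
  and ide_right [simp]: "\<lbrakk>f \<in> ar; sr f = X\<rbrakk> \<Longrightarrow> f \<cdot> ide X = f"
  using ident_left[of f "sr f" Y] ident_right[of f X "tg f"] by (simp_all add: hom_iff)

lemma iso_arr: "iso_arr B f \<Longrightarrow> f \<in> ar"
  by (auto simp: iso_arr_def inverse_arrows_def)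

lemma inverse_arrows_inv: "iso_arr B f \<Longrightarrow> inverse_arrows B f (ainv f)"
proof -
  assume "iso_arr B f"
  then obtain g where g: "inverse_arrows B f g" by (auto simp: iso_arr_def)
  have "h = g" if "inverse_arrows B f h" for h
  proof -
    have "h = h \<cdot> f \<cdot> g"
      using that g by (simp add: inverse_arrows_def hom_iff)
    also have "\<dots> = (h \<cdot> f) \<cdot> g"
      using that g by (subst cmp_assoc') (auto simp: inverse_arrows_def hom_iff)
    also have "\<dots> = g"
      using that g by (simp add: inverse_arrows_def hom_iff)
    finally show ?thesis .
  qed
  then show ?thesis
    unfolding arr_inv_def using g by (metis theI)
qed

lemma inv_typed [simp]:
  assumes "iso_arr B f"
  shows "ainv f \<in> ar" "sr (ainv f) = tg f" "tg (ainv f) = sr f"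
    and inv_left: "ainv f \<cdot> f = ide (sr f)" and inv_right: "f \<cdot> ainv f = ide (tg f)"
  using inverse_arrows_inv[OF assms] by (auto simp: inverse_arrows_def hom_iff)

lemma iso_cancel_right:
  assumes "iso_arr B k" "f \<in> ar" "g \<in> ar" "sr f = tg k" "sr g = tg k" "f \<cdot> k = g \<cdot> k"
  shows "f = g"
proof -
  have "h = (h \<cdot> k) \<cdot> ainv k" if "h \<in> ar" "sr h = tg k" for h
    using that assms(1) iso_arr[OF assms(1)] by (simp add: cmp_assoc' inv_right)
  then show ?thesis using assms by metis
qed

lemma iso_cancel_left:
  assumes "iso_arr B k" "f \<in> ar" "g \<in> ar" "tg f = sr k" "tg g = sr k" "k \<cdot> f = k \<cdot> g"
  shows "f = g"
proof -
  have "h = ainv k \<cdot> k \<cdot> h" if "h \<in> ar" "tg h = sr k" for h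
    using that assms(1) iso_arr[OF assms(1)] by (simp add: cmp_assoc'[symmetric] inv_left)
  then show ?thesis using assms by metis
qed

lemma iso_arrI:
  assumes "f \<in> ar" "g \<in> ar" "sr g = tg f" "tg g = sr f" "g \<cdot> f = ide (sr f)" "f \<cdot> g = ide (tg f)"
  shows "iso_arr B f"
  using assms by (auto simp: iso_arr_def inverse_arrows_def hom_iff)

lemma iso_ide [simp]: "X \<in> obj B \<Longrightarrow> iso_arr B (ide X)"
  by (rule iso_arrI[of _ "ide X"]) simp_all

lemma inv_cancel_left: "\<lbrakk>iso_arr B f; g \<in> ar; tg g = sr f\<rbrakk> \<Longrightarrow> ainv f \<cdot> f \<cdot> g = g"
  and inv_cancel_right: "\<lbrakk>iso_arr B f; g \<in> ar; tg g = tg f\<rbrakk> \<Longrightarrow> f \<cdot> ainv f \<cdot> g = g"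
  by (simp_all add: cmp_assoc'[symmetric] iso_arr inv_left inv_right)

lemma iso_cmp [simp]:
  assumes "iso_arr B f" "iso_arr B g" "tg f = sr g"
  shows "iso_arr B (g \<cdot> f)"
  using assms iso_arr[OF assms(1)] iso_arr[OF assms(2)]
  by (intro iso_arrI[of _ "ainv f \<cdot> ainv g"])
    (simp_all add: cmp_assoc' inv_left inv_right inv_cancel_left inv_cancel_right)

end

section \<open>Coherence of the unit constraints\<close>

context monoidal_category
begin

lemma tens_typed [simp]:
  assumes "f \<in> ar" "g \<in> ar"
  shows "f \<otimes> g \<in> ar" "sr (f \<otimes> g) = sr f \<odot> sr g" "tg (f \<otimes> g) = tg f \<odot> tg g"
  using tens_hom[of f "sr f" "tg f" g "sr g" "tg g"] assms by (auto simp: hom_iff)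

declare tens_obj [simp] unit_obj [simp] asc_iso [simp] lunit_iso [simp] runit_iso [simp]

lemma asc_typed [simp]:
  assumes "X \<in> obj B" "Y \<in> obj B" "Z \<in> obj B"
  shows "asc B X Y Z \<in> ar" "sr (asc B X Y Z) = (X \<odot> Y) \<odot> Z" "tg (asc B X Y Z) = X \<odot> Y \<odot> Z"
  using asc_hom[OF assms] by (auto simp: hom_iff)

lemma lunit_typed [simp]:
  assumes "X \<in> obj B"
  shows "lunit B X \<in> ar" "sr (lunit B X) = \<one> \<odot> X" "tg (lunit B X) = X"
  using lunit_hom[OF assms] by (auto simp: hom_iff)

lemma runit_typed [simp]:
  assumes "X \<in> obj B"
  shows "runit B X \<in> ar" "sr (runit B X) = X \<odot> \<one>" "tg (runit B X) = X"
  using runit_hom[OF assms] by (auto simp: hom_iff)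

lemma tens_cmp': "\<lbrakk>f \<in> ar; g \<in> ar; f' \<in> ar; g' \<in> ar; tg f = sr g; tg f' = sr g'\<rbrakk>
    \<Longrightarrow> (g \<otimes> g') \<cdot> (f \<otimes> f') = (g \<cdot> f) \<otimes> (g' \<cdot> f')"
  using tens_cmp[of f "sr f" "tg f" g "tg g" f' "sr f'" "tg f'" g' "tg g'"] by (simp add: hom_iff)

lemma tens_cmp_left: "\<lbrakk>f \<in> ar; g \<in> ar; tg f = sr g; X \<in> obj B\<rbrakk>
    \<Longrightarrow> (g \<cdot> f) \<otimes> ide X = (g \<otimes> ide X) \<cdot> (f \<otimes> ide X)"
  and tens_cmp_right: "\<lbrakk>f \<in> ar; g \<in> ar; tg f = sr g; X \<in> obj B\<rbrakk>
    \<Longrightarrow> ide X \<otimes> (g \<cdot> f) = (ide X \<otimes> g) \<cdot> (ide X \<otimes> f)"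
  by (simp_all add: tens_cmp')

lemma iso_tens [simp]:
  assumes "iso_arr B f" "iso_arr B g"
  shows "iso_arr B (f \<otimes> g)"
  using assms iso_arr[OF assms(1)] iso_arr[OF assms(2)]
  by (intro iso_arrI[of _ "ainv f \<otimes> ainv g"]) (simp_all add: tens_cmp' inv_left inv_right tens_ident)

lemma asc_nat: "\<lbrakk>f \<in> ar; g \<in> ar; h \<in> ar\<rbrakk> \<Longrightarrow>
    asc B (tg f) (tg g) (tg h) \<cdot> ((f \<otimes> g) \<otimes> h) = (f \<otimes> g \<otimes> h) \<cdot> asc B (sr f) (sr g) (sr h)"
  using asc_natural[of f "sr f" "tg f" g "sr g" "tg g" h "sr h" "tg h"] by (simp add: hom_iff)

lemma lunit_nat: "f \<in> ar \<Longrightarrow> lunit B (tg f) \<cdot> (ide \<one> \<otimes> f) = f \<cdot> lunit B (sr f)"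
  using lunit_natural[of f "sr f" "tg f"] by (simp add: hom_iff)

lemma runit_nat: "f \<in> ar \<Longrightarrow> runit B (tg f) \<cdot> (f \<otimes> ide \<one>) = f \<cdot> runit B (sr f)"
  using runit_natural[of f "sr f" "tg f"] by (simp add: hom_iff)

text \<open>\<open>lunit\<close> makes tensoring with \<one> naturally isomorphic to the identity
  functor, hence faithful. Coherence equations can thus be checked after whiskering by \<one>, where
  the pentagon applies.\<close>

lemma unit_tens_cancel:
  assumes "f \<in> ar" "g \<in> ar" "sr f = sr g" "tg f = tg g" "ide \<one> \<otimes> f = ide \<one> \<otimes> g"
  shows "f = g"
proof (rule iso_cancel_right[of "lunit B (sr f)"])
  show "f \<cdot> lunit B (sr f) = g \<cdot> lunit B (sr f)"
    using assms lunit_nat[of f] lunit_nat[of g] by simp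
qed (use assms in simp_all)

lemma tens_unit_cancel:
  assumes "f \<in> ar" "g \<in> ar" "sr f = sr g" "tg f = tg g" "f \<otimes> ide \<one> = g \<otimes> ide \<one>"
  shows "f = g"
proof (rule iso_cancel_right[of "runit B (sr f)"])
  show "f \<cdot> runit B (sr f) = g \<cdot> runit B (sr f)"
    using assms runit_nat[of f] runit_nat[of g] by simp
qed (use assms in simp_all)

text \<open>The next three lemmas are Kelly's redundant coherence axioms.\<close>

lemma lunit_tens:
  assumes [simp]: "X \<in> obj B" "Y \<in> obj B"
  shows "lunit B (X \<odot> Y) \<cdot> asc B \<one> X Y = lunit B X \<otimes> ide Y"
proof (rule unit_tens_cancel)
  let ?k = "asc B \<one> (\<one> \<odot> X) Y \<cdot> (asc B \<one> \<one> X \<otimes> ide Y)"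
  have "(ide \<one> \<otimes> (lunit B (X \<odot> Y) \<cdot> asc B \<one> X Y)) \<cdot> ?k =
      (ide \<one> \<otimes> lunit B (X \<odot> Y)) \<cdot> (ide \<one> \<otimes> asc B \<one> X Y) \<cdot> asc B \<one> (\<one> \<odot> X) Y \<cdot> (asc B \<one> \<one> X \<otimes> ide Y)"
    by (simp add: tens_cmp_right cmp_assoc')
  also have "\<dots> = (ide \<one> \<otimes> lunit B (X \<odot> Y)) \<cdot> asc B \<one> \<one> (X \<odot> Y) \<cdot> asc B (\<one> \<odot> \<one>) X Y"
    using pentagon[of \<one> \<one> X Y] by simp
  also have "\<dots> = (runit B \<one> \<otimes> ide (X \<odot> Y)) \<cdot> asc B (\<one> \<odot> \<one>) X Y"
    using triangle[of \<one> "X \<odot> Y"] by (simp add: cmp_assoc'[symmetric])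
  also have "\<dots> = asc B \<one> X Y \<cdot> ((runit B \<one> \<otimes> ide X) \<otimes> ide Y)"
    using asc_nat[of "runit B \<one>" "ide X" "ide Y"] by (simp add: tens_ident)
  also have "\<dots> = asc B \<one> X Y \<cdot> ((ide \<one> \<otimes> lunit B X) \<otimes> ide Y) \<cdot> (asc B \<one> \<one> X \<otimes> ide Y)"
    by (simp add: triangle[symmetric] tens_cmp_left)
  also have "\<dots> = (ide \<one> \<otimes> (lunit B X \<otimes> ide Y)) \<cdot> ?k"
    using asc_nat[of "ide \<one>" "lunit B X" "ide Y"] by (simp add: cmp_assoc'[symmetric])
  finally show "ide \<one> \<otimes> (lunit B (X \<odot> Y) \<cdot> asc B \<one> X Y) = ide \<one> \<otimes> (lunit B X \<otimes> ide Y)"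
    by (rule iso_cancel_right[of ?k, rotated -1]) simp_all
qed simp_all

lemma runit_tens:
  assumes [simp]: "X \<in> obj B" "Y \<in> obj B"
  shows "(ide X \<otimes> runit B Y) \<cdot> asc B X Y \<one> = runit B (X \<odot> Y)"
proof (rule tens_unit_cancel)
  have "asc B X Y \<one> \<cdot> (((ide X \<otimes> runit B Y) \<cdot> asc B X Y \<one>) \<otimes> ide \<one>) =
      (ide X \<otimes> (runit B Y \<otimes> ide \<one>)) \<cdot> asc B X (Y \<odot> \<one>) \<one> \<cdot> (asc B X Y \<one> \<otimes> ide \<one>)"
    using asc_nat[of "ide X" "runit B Y" "ide \<one>"] by (simp add: tens_cmp_left cmp_assoc'[symmetric])
  also have "\<dots> = (ide X \<otimes> ide Y \<otimes> lunit B \<one>) \<cdot> (ide X \<otimes> asc B Y \<one> \<one>) \<cdot> asc B X (Y \<odot> \<one>) \<one> \<cdot> (asc B X Y \<one> \<otimes> ide \<one>)"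
    by (simp add: triangle[symmetric] tens_cmp_right cmp_assoc')
  also have "\<dots> = (ide X \<otimes> ide Y \<otimes> lunit B \<one>) \<cdot> asc B X Y (\<one> \<odot> \<one>) \<cdot> asc B (X \<odot> Y) \<one> \<one>"
    using pentagon[of X Y \<one> \<one>] by simp
  also have "\<dots> = asc B X Y \<one> \<cdot> (ide (X \<odot> Y) \<otimes> lunit B \<one>) \<cdot> asc B (X \<odot> Y) \<one> \<one>"
    using asc_nat[of "ide X" "ide Y" "lunit B \<one>"] by (simp add: cmp_assoc'[symmetric] tens_ident)
  also have "\<dots> = asc B X Y \<one> \<cdot> (runit B (X \<odot> Y) \<otimes> ide \<one>)"
    by (simp add: triangle)
  finally show "((ide X \<otimes> runit B Y) \<cdot> asc B X Y \<one>) \<otimes> ide \<one> = runit B (X \<odot> Y) \<otimes> ide \<one>"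
    by (rule iso_cancel_left[of "asc B X Y \<one>", rotated -1]) simp_all
qed simp_all

lemma lunit_unit: "lunit B \<one> = runit B \<one>"
proof (rule tens_unit_cancel)
  have "lunit B \<one> \<cdot> (ide \<one> \<otimes> lunit B \<one>) = lunit B \<one> \<cdot> lunit B (\<one> \<odot> \<one>)"
    using lunit_nat[of "lunit B \<one>"] by simp
  then have "ide \<one> \<otimes> lunit B \<one> = lunit B (\<one> \<odot> \<one>)"
    by (rule iso_cancel_left[of "lunit B \<one>", rotated -1]) simp_all
  then show "lunit B \<one> \<otimes> ide \<one> = runit B \<one> \<otimes> ide \<one>"
    using lunit_tens[of \<one> \<one>] triangle[of \<one> \<one>] by simp
qed simp_all

section \<open>Words of objects and their canonical isomorphisms\<close>

abbreviation "wo \<equiv> word_obj B"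
abbreviation "objs xs \<equiv> set xs \<subseteq> obj B"

lemma word_obj_Cons: "xs \<noteq> [] \<Longrightarrow> wo (X # xs) = X \<odot> wo xs"
  by (cases xs) simp_all

lemma merge_Cons: "xs \<noteq> [] \<Longrightarrow> merge B (X # xs) ys = (ide X \<otimes> merge B xs ys) \<cdot> asc B X (wo xs) (wo ys)"
  by (cases xs) simp_all

lemma word_obj_obj [simp]: "objs xs \<Longrightarrow> wo xs \<in> obj B"
  by (induction xs rule: induct_list012) simp_all

lemma merge_props:
  assumes "objs xs" "objs ys"
  shows "merge B xs ys \<in> ar \<and> sr (merge B xs ys) = wo xs \<odot> wo ys \<and>
    tg (merge B xs ys) = wo (xs @ ys) \<and> iso_arr B (merge B xs ys)"
  using assms
proof (induction xs)
  case (Cons X xs)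
  show ?case
  proof (cases "xs = []")
    case True
    then show ?thesis using Cons.prems by (cases ys) simp_all
  next
    case False
    then show ?thesis using Cons by (simp add: word_obj_Cons merge_Cons)
  qed
qed simp

lemma merge_typed [simp]:
  assumes "objs xs" "objs ys"
  shows "merge B xs ys \<in> ar" "sr (merge B xs ys) = wo xs \<odot> wo ys"
    "tg (merge B xs ys) = wo (xs @ ys)" "iso_arr B (merge B xs ys)"
  using merge_props[OF assms] by auto

lemma merge_Nil:
  assumes "objs xs"
  shows "merge B xs [] = runit B (wo xs)"
  using assms
proof (induction xs)
  case (Cons X xs)
  then show ?case by (cases "xs = []") (simp_all add: merge_Cons word_obj_Cons runit_tens)
qed (simp add: lunit_unit)

text \<open>The coherence fact behind strictness. The empty word is \<open>lunit_tens\<close> with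
  naturality of \<open>lunit\<close>, a single letter needs the triangle exactly when
  \<open>ys\<close> is empty, and a longer word reduces to the pentagon.\<close>

lemma merge_assoc:
  assumes "objs xs" "objs ys" "objs zs"
  shows "merge B (xs @ ys) zs \<cdot> (merge B xs ys \<otimes> ide (wo zs)) =
    merge B xs (ys @ zs) \<cdot> (ide (wo xs) \<otimes> merge B ys zs) \<cdot> asc B (wo xs) (wo ys) (wo zs)"
  using assms(1)
proof (induction xs)
  case Nil
  note [simp] = assms(2,3)
  have "merge B ys zs \<cdot> (lunit B (wo ys) \<otimes> ide (wo zs)) =
      (merge B ys zs \<cdot> lunit B (wo ys \<odot> wo zs)) \<cdot> asc B \<one> (wo ys) (wo zs)"
    by (simp add: lunit_tens[symmetric] cmp_assoc')
  also have "\<dots> = (lunit B (wo (ys @ zs)) \<cdot> (ide \<one> \<otimes> merge B ys zs)) \<cdot> asc B \<one> (wo ys) (wo zs)"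
    using lunit_nat[of "merge B ys zs"] by simp
  finally show ?case by (simp add: cmp_assoc')
next
  case (Cons X xs)
  note [simp] = assms(2,3)
  have [simp]: "X \<in> obj B" "objs xs" using Cons.prems by simp_all
  show ?case
  proof (cases "xs = []")
    case xs: True
    show ?thesis
    proof (cases "ys = []")
      case True
      then show ?thesis by (simp add: xs triangle)
    next
      case False
      then have "merge B [X] (ys @ us) = ide (X \<odot> wo (ys @ us))" for us by (cases ys) simp_all
      from this[of "[]"] this[of zs] False show ?thesis
        by (simp add: xs merge_Cons word_obj_Cons tens_ident)
    qed
  next
    case False
    let ?X = "wo xs" and ?Y = "wo ys" and ?Z = "wo zs"
    have "merge B ((X # xs) @ ys) zs \<cdot> (merge B (X # xs) ys \<otimes> ide ?Z) =
        (ide X \<otimes> merge B (xs @ ys) zs) \<cdot> (asc B X (wo (xs @ ys)) ?Z \<cdot> ((ide X \<otimes> merge B xs ys) \<otimes> ide ?Z)) \<cdot>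
        (asc B X ?X ?Y \<otimes> ide ?Z)"
      using False by (simp add: merge_Cons tens_cmp_left cmp_assoc')
    also have "asc B X (wo (xs @ ys)) ?Z \<cdot> ((ide X \<otimes> merge B xs ys) \<otimes> ide ?Z) =
        (ide X \<otimes> (merge B xs ys \<otimes> ide ?Z)) \<cdot> asc B X (?X \<odot> ?Y) ?Z"
      using asc_nat[of "ide X" "merge B xs ys" "ide ?Z"] by simp
    also have "(ide X \<otimes> merge B (xs @ ys) zs) \<cdot> ((ide X \<otimes> (merge B xs ys \<otimes> ide ?Z)) \<cdot> asc B X (?X \<odot> ?Y) ?Z) \<cdot>
        (asc B X ?X ?Y \<otimes> ide ?Z) =
        (ide X \<otimes> (merge B (xs @ ys) zs \<cdot> (merge B xs ys \<otimes> ide ?Z))) \<cdot> asc B X (?X \<odot> ?Y) ?Z \<cdot>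
        (asc B X ?X ?Y \<otimes> ide ?Z)"
      by (simp add: tens_cmp_right cmp_assoc')
    also have "\<dots> = (ide X \<otimes> merge B xs (ys @ zs)) \<cdot> (ide X \<otimes> ide ?X \<otimes> merge B ys zs) \<cdot>
        (ide X \<otimes> asc B ?X ?Y ?Z) \<cdot> asc B X (?X \<odot> ?Y) ?Z \<cdot> (asc B X ?X ?Y \<otimes> ide ?Z)"
      using Cons.IH by (simp add: tens_cmp_right cmp_assoc')
    also have "\<dots> = (ide X \<otimes> merge B xs (ys @ zs)) \<cdot> (ide X \<otimes> ide ?X \<otimes> merge B ys zs) \<cdot>
        asc B X ?X (?Y \<odot> ?Z) \<cdot> asc B (X \<odot> ?X) ?Y ?Z"
      using pentagon[of X ?X ?Y ?Z] by simp
    also have "\<dots> = (ide X \<otimes> merge B xs (ys @ zs)) \<cdot> (asc B X ?X (wo (ys @ zs)) \<cdot>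
        (ide (X \<odot> ?X) \<otimes> merge B ys zs)) \<cdot> asc B (X \<odot> ?X) ?Y ?Z"
      using asc_nat[of "ide X" "ide ?X" "merge B ys zs"] by (simp add: tens_ident cmp_assoc')
    finally show ?thesis
      using False by (simp add: merge_Cons word_obj_Cons cmp_assoc')
  qed
qed

section \<open>The strict tensor product of word arrows\<close>

definition warr :: "('o, 'a) word_arr \<Rightarrow> bool" where
  "warr f \<longleftrightarrow> f \<in> word_hom B (wsrc f) (wtrg f)"

lemma word_hom_iff: "f \<in> word_hom B xs ys \<longleftrightarrow> warr f \<and> wsrc f = xs \<and> wtrg f = ys"
  by (cases f) (auto simp: warr_def word_hom_def)

lemma warr_iff: "warr f \<longleftrightarrow>
    objs (wsrc f) \<and> objs (wtrg f) \<and> und f \<in> ar \<and> sr (und f) = wo (wsrc f) \<and> tg (und f) = wo (wtrg f)"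
  by (cases f) (auto simp: warr_def word_hom_def hom_iff)

lemma warr_typed [simp]:
  assumes "warr f"
  shows "objs (wsrc f)" "objs (wtrg f)" "und f \<in> ar" "sr (und f) = wo (wsrc f)" "tg (und f) = wo (wtrg f)"
  using assms by (simp_all add: warr_iff)

lemma wid_typed [simp]: "objs xs \<Longrightarrow> warr (wid B xs)" "wsrc (wid B xs) = xs" "wtrg (wid B xs) = xs"
  "und (wid B xs) = ide (wo xs)"
  by (simp_all add: wid_def warr_iff del: warr_typed)

lemma wcmp_typed [simp]:
  "wsrc (g \<bullet> f) = wsrc f" "wtrg (g \<bullet> f) = wtrg g" "und (g \<bullet> f) = und g \<cdot> und f"
  "\<lbrakk>warr f; warr g; wtrg f = wsrc g\<rbrakk> \<Longrightarrow> warr (g \<bullet> f)"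
  by (simp_all add: wcmp_def warr_iff del: warr_typed)

lemma wtens_typed [simp]:
  "wsrc (f \<boxtimes> g) = wsrc f @ wsrc g" "wtrg (f \<boxtimes> g) = wtrg f @ wtrg g"
  "\<lbrakk>warr f; warr g\<rbrakk> \<Longrightarrow> warr (f \<boxtimes> g)"
  by (simp_all add: wtens_def warr_iff del: warr_typed)

lemma wtens_merge: "\<lbrakk>warr f; warr g\<rbrakk> \<Longrightarrow>
    und (f \<boxtimes> g) \<cdot> merge B (wsrc f) (wsrc g) = merge B (wtrg f) (wtrg g) \<cdot> (und f \<otimes> und g)"
  by (simp add: wtens_def cmp_assoc' inv_left)

text \<open>Tensor products of word arrows are conjugated by \<open>merge\<close>; precomposing with
  an invertible \<open>k\<close> clears the inverses of \<open>merge\<close> and loses no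
  information.\<close>

lemma warr_eqI:
  assumes "warr f" "warr g" "wsrc f = wsrc g" "wtrg f = wtrg g"
    and "iso_arr B k" "tg k = wo (wsrc f)" "und f \<cdot> k = und g \<cdot> k"
  shows "f = g"
proof -
  have "und f = und g"
    by (rule iso_cancel_right[of k]) (use assms iso_arr[of k] in simp_all)
  then show ?thesis using assms by (cases f; cases g) simp
qed

lemma wcmp_assoc: "\<lbrakk>warr f; warr g; warr h; wtrg f = wsrc g; wtrg g = wsrc h\<rbrakk>
    \<Longrightarrow> (h \<bullet> g) \<bullet> f = h \<bullet> g \<bullet> f"
  by (rule word_arr.expand) (simp add: cmp_assoc')

lemma wid_left: "warr f \<Longrightarrow> wtrg f = xs \<Longrightarrow> wid B xs \<bullet> f = f"
  and wid_right: "warr f \<Longrightarrow> wsrc f = xs \<Longrightarrow> f \<bullet> wid B xs = f"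
  by (auto intro!: word_arr.expand)

lemma wtens_wcmp:
  assumes [simp]: "warr f" "warr g" "warr f'" "warr g'" "wtrg f = wsrc g" "wtrg f' = wsrc g'"
  shows "(g \<bullet> f) \<boxtimes> (g' \<bullet> f') = (g \<boxtimes> g') \<bullet> (f \<boxtimes> f')"
proof (rule warr_eqI[where k = "merge B (wsrc f) (wsrc f')"])
  have "und ((g \<bullet> f) \<boxtimes> (g' \<bullet> f')) \<cdot> merge B (wsrc f) (wsrc f') =
      merge B (wtrg g) (wtrg g') \<cdot> (und g \<otimes> und g') \<cdot> (und f \<otimes> und f')"
    using wtens_merge[of "g \<bullet> f" "g' \<bullet> f'"] by (simp add: tens_cmp')
  also have "\<dots> = (und (g \<boxtimes> g') \<cdot> merge B (wsrc g) (wsrc g')) \<cdot> (und f \<otimes> und f')"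
    by (simp add: wtens_merge cmp_assoc')
  also have "\<dots> = und ((g \<boxtimes> g') \<bullet> (f \<boxtimes> f')) \<cdot> merge B (wsrc f) (wsrc f')"
    using wtens_merge[of f f'] by (simp add: cmp_assoc')
  finally show "und ((g \<bullet> f) \<boxtimes> (g' \<bullet> f')) \<cdot> merge B (wsrc f) (wsrc f') =
      und ((g \<boxtimes> g') \<bullet> (f \<boxtimes> f')) \<cdot> merge B (wsrc f) (wsrc f')" .
qed simp_all

lemma wtens_wid:
  assumes [simp]: "objs xs" "objs ys"
  shows "wid B xs \<boxtimes> wid B ys = wid B (xs @ ys)"
proof (rule warr_eqI[where k = "merge B xs ys"])
  show "und (wid B xs \<boxtimes> wid B ys) \<cdot> merge B xs ys = und (wid B (xs @ ys)) \<cdot> merge B xs ys"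
    using wtens_merge[of "wid B xs" "wid B ys"] by (simp add: tens_ident)
qed simp_all

lemma wtens_Nil_left:
  assumes [simp]: "warr f"
  shows "wid B [] \<boxtimes> f = f"
proof (rule warr_eqI[where k = "lunit B (wo (wsrc f))"])
  show "und (wid B [] \<boxtimes> f) \<cdot> lunit B (wo (wsrc f)) = und f \<cdot> lunit B (wo (wsrc f))"
    using wtens_merge[of "wid B []" f] lunit_nat[of "und f"] by simp
qed simp_all

lemma wtens_Nil_right:
  assumes [simp]: "warr f"
  shows "f \<boxtimes> wid B [] = f"
proof (rule warr_eqI[where k = "runit B (wo (wsrc f))"])
  show "und (f \<boxtimes> wid B []) \<cdot> runit B (wo (wsrc f)) = und f \<cdot> runit B (wo (wsrc f))"
    using wtens_merge[of f "wid B []"] runit_nat[of "und f"] by (simp add: merge_Nil)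
qed simp_all

lemma wtens_assoc:
  assumes [simp]: "warr f" "warr g" "warr h"
  shows "(f \<boxtimes> g) \<boxtimes> h = f \<boxtimes> g \<boxtimes> h"
proof (rule warr_eqI)
  let ?k = "merge B (wsrc f @ wsrc g) (wsrc h) \<cdot> (merge B (wsrc f) (wsrc g) \<otimes> ide (wo (wsrc h)))"
  let ?l = "merge B (wtrg f @ wtrg g) (wtrg h) \<cdot> (merge B (wtrg f) (wtrg g) \<otimes> ide (wo (wtrg h)))"
  have "und ((f \<boxtimes> g) \<boxtimes> h) \<cdot> ?k = merge B (wtrg f @ wtrg g) (wtrg h) \<cdot> (und (f \<boxtimes> g) \<otimes> und h) \<cdot>
      (merge B (wsrc f) (wsrc g) \<otimes> ide (wo (wsrc h)))"
    using wtens_merge[of "f \<boxtimes> g" h] by (simp add: cmp_assoc'[symmetric])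
  also have "\<dots> = ?l \<cdot> ((und f \<otimes> und g) \<otimes> und h)"
    by (simp add: tens_cmp' wtens_merge cmp_assoc')
  finally have 1: "und ((f \<boxtimes> g) \<boxtimes> h) \<cdot> ?k = ?l \<cdot> ((und f \<otimes> und g) \<otimes> und h)" .
  have "und (f \<boxtimes> g \<boxtimes> h) \<cdot> ?k = (und (f \<boxtimes> g \<boxtimes> h) \<cdot> merge B (wsrc f) (wsrc g @ wsrc h)) \<cdot>
      (ide (wo (wsrc f)) \<otimes> merge B (wsrc g) (wsrc h)) \<cdot> asc B (wo (wsrc f)) (wo (wsrc g)) (wo (wsrc h))"
    by (simp add: merge_assoc cmp_assoc')
  also have "\<dots> = merge B (wtrg f) (wtrg g @ wtrg h) \<cdot> ((und f \<otimes> und (g \<boxtimes> h)) \<cdot>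
      (ide (wo (wsrc f)) \<otimes> merge B (wsrc g) (wsrc h))) \<cdot> asc B (wo (wsrc f)) (wo (wsrc g)) (wo (wsrc h))"
    using wtens_merge[of f "g \<boxtimes> h"] by (simp add: cmp_assoc')
  also have "(und f \<otimes> und (g \<boxtimes> h)) \<cdot> (ide (wo (wsrc f)) \<otimes> merge B (wsrc g) (wsrc h)) =
      (ide (wo (wtrg f)) \<otimes> merge B (wtrg g) (wtrg h)) \<cdot> (und f \<otimes> und g \<otimes> und h)"
    by (simp add: tens_cmp' wtens_merge)
  also have "merge B (wtrg f) (wtrg g @ wtrg h) \<cdot> \<dots> \<cdot> asc B (wo (wsrc f)) (wo (wsrc g)) (wo (wsrc h)) =
      ?l \<cdot> ((und f \<otimes> und g) \<otimes> und h)"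
    using asc_nat[of "und f" "und g" "und h"] by (simp add: merge_assoc cmp_assoc')
  finally show "und ((f \<boxtimes> g) \<boxtimes> h) \<cdot> ?k = und (f \<boxtimes> g \<boxtimes> h) \<cdot> ?k"
    using 1 by simp
qed simp_all

end

section \<open>The braiding on words\<close>

context braided_monoidal_category
begin

lemma braid_typed [simp]:
  assumes "X \<in> obj B" "Y \<in> obj B"
  shows "braid B X Y \<in> ar" "sr (braid B X Y) = X \<odot> Y" "tg (braid B X Y) = Y \<odot> X"
    "iso_arr B (braid B X Y)"
  using braid_hom[OF assms] braid_iso[OF assms] by (auto simp: hom_iff)

lemma braid_nat: "f \<in> ar \<Longrightarrow> g \<in> ar \<Longrightarrow>
    braid B (tg f) (tg g) \<cdot> (f \<otimes> g) = (g \<otimes> f) \<cdot> braid B (sr f) (sr g)"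
  using braid_natural[of f "sr f" "tg f" g "sr g" "tg g"] by (simp add: hom_iff)

lemma wbraid_typed [simp]:
  "wsrc (wbraid B xs ys) = xs @ ys" "wtrg (wbraid B xs ys) = ys @ xs"
  "\<lbrakk>objs xs; objs ys\<rbrakk> \<Longrightarrow> warr (wbraid B xs ys)"
  "\<lbrakk>objs xs; objs ys\<rbrakk> \<Longrightarrow> iso_arr B (und (wbraid B xs ys))"
proof -
  have "iso_arr B (ainv f)" if "iso_arr B f" for f
    using that iso_arr[OF that] by (intro iso_arrI[of _ f]) (simp_all add: inv_left inv_right)
  then show "\<lbrakk>objs xs; objs ys\<rbrakk> \<Longrightarrow> iso_arr B (und (wbraid B xs ys))"
    by (simp add: wbraid_def)
qed (simp_all add: wbraid_def warr_iff del: warr_typed)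

lemma wbraid_merge: "\<lbrakk>objs xs; objs ys\<rbrakk> \<Longrightarrow>
    und (wbraid B xs ys) \<cdot> merge B xs ys = merge B ys xs \<cdot> braid B (wo xs) (wo ys)"
  by (simp add: wbraid_def cmp_assoc' inv_left)

lemma wbraid_natural:
  assumes [simp]: "warr f" "warr g"
  shows "wbraid B (wtrg f) (wtrg g) \<bullet> (f \<boxtimes> g) = (g \<boxtimes> f) \<bullet> wbraid B (wsrc f) (wsrc g)"
proof (rule warr_eqI[where k = "merge B (wsrc f) (wsrc g)"])
  have "und (wbraid B (wtrg f) (wtrg g) \<bullet> (f \<boxtimes> g)) \<cdot> merge B (wsrc f) (wsrc g) =
      (und (wbraid B (wtrg f) (wtrg g)) \<cdot> merge B (wtrg f) (wtrg g)) \<cdot> (und f \<otimes> und g)"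
    by (simp add: wtens_merge cmp_assoc')
  also have "\<dots> = (merge B (wtrg g) (wtrg f) \<cdot> (und g \<otimes> und f)) \<cdot> braid B (wo (wsrc f)) (wo (wsrc g))"
    using braid_nat[of "und f" "und g"] by (simp add: wbraid_merge cmp_assoc')
  also have "\<dots> = (und (g \<boxtimes> f) \<cdot> merge B (wsrc g) (wsrc f)) \<cdot> braid B (wo (wsrc f)) (wo (wsrc g))"
    by (simp add: wtens_merge)
  also have "\<dots> = und ((g \<boxtimes> f) \<bullet> wbraid B (wsrc f) (wsrc g)) \<cdot> merge B (wsrc f) (wsrc g)"
    by (simp add: wbraid_merge cmp_assoc')
  finally show "und (wbraid B (wtrg f) (wtrg g) \<bullet> (f \<boxtimes> g)) \<cdot> merge B (wsrc f) (wsrc g) =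
      und ((g \<boxtimes> f) \<bullet> wbraid B (wsrc f) (wsrc g)) \<cdot> merge B (wsrc f) (wsrc g)" .
qed simp_all

text \<open>\<open>merge_assoc\<close> solved for the other bracketing, because the second hexagon
  axiom is stated with inverse associators.\<close>

lemma merge_assoc':
  assumes [simp]: "objs xs" "objs ys" "objs zs"
  shows "merge B (xs @ ys) zs \<cdot> (merge B xs ys \<otimes> ide (wo zs)) \<cdot> ainv (asc B (wo xs) (wo ys) (wo zs)) =
    merge B xs (ys @ zs) \<cdot> (ide (wo xs) \<otimes> merge B ys zs)"
proof -
  have "(merge B (xs @ ys) zs \<cdot> (merge B xs ys \<otimes> ide (wo zs))) \<cdot> ainv (asc B (wo xs) (wo ys) (wo zs)) =
      merge B xs (ys @ zs) \<cdot> (ide (wo xs) \<otimes> merge B ys zs)"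
    by (subst merge_assoc) (simp_all add: cmp_assoc' inv_right)
  then show ?thesis by (simp add: cmp_assoc')
qed

lemma wbraid_append_right:
  assumes [simp]: "objs xs" "objs ys" "objs zs"
  shows "wbraid B xs (ys @ zs) = (wid B ys \<boxtimes> wbraid B xs zs) \<bullet> (wbraid B xs ys \<boxtimes> wid B zs)"
proof (rule warr_eqI)
  let ?X = "wo xs" and ?Y = "wo ys" and ?Z = "wo zs"
  let ?k = "merge B (xs @ ys) zs \<cdot> (merge B xs ys \<otimes> ide ?Z)"
  let ?r = "merge B (ys @ zs) xs \<cdot> (merge B ys zs \<otimes> ide ?X) \<cdot> braid B ?X (?Y \<odot> ?Z) \<cdot> asc B ?X ?Y ?Z"
  have "und (wbraid B xs (ys @ zs)) \<cdot> ?k =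
      (und (wbraid B xs (ys @ zs)) \<cdot> merge B xs (ys @ zs)) \<cdot> (ide ?X \<otimes> merge B ys zs) \<cdot> asc B ?X ?Y ?Z"
    by (simp add: merge_assoc cmp_assoc')
  also have "\<dots> = merge B (ys @ zs) xs \<cdot> (braid B ?X (wo (ys @ zs)) \<cdot> (ide ?X \<otimes> merge B ys zs)) \<cdot> asc B ?X ?Y ?Z"
    by (simp add: wbraid_merge cmp_assoc')
  also have "\<dots> = ?r"
    using braid_nat[of "ide ?X" "merge B ys zs"] by (simp add: cmp_assoc')
  finally have 1: "und (wbraid B xs (ys @ zs)) \<cdot> ?k = ?r" .
  have "und ((wid B ys \<boxtimes> wbraid B xs zs) \<bullet> (wbraid B xs ys \<boxtimes> wid B zs)) \<cdot> ?k =
      und (wid B ys \<boxtimes> wbraid B xs zs) \<cdot> (und (wbraid B xs ys \<boxtimes> wid B zs) \<cdot> merge B (xs @ ys) zs) \<cdot>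
      (merge B xs ys \<otimes> ide ?Z)"
    by (simp add: cmp_assoc')
  also have "\<dots> = und (wid B ys \<boxtimes> wbraid B xs zs) \<cdot> merge B (ys @ xs) zs \<cdot>
      (und (wbraid B xs ys) \<otimes> ide ?Z) \<cdot> (merge B xs ys \<otimes> ide ?Z)"
    using wtens_merge[of "wbraid B xs ys" "wid B zs"] by (simp add: cmp_assoc')
  also have "\<dots> = und (wid B ys \<boxtimes> wbraid B xs zs) \<cdot> (merge B (ys @ xs) zs \<cdot> (merge B ys xs \<otimes> ide ?Z)) \<cdot>
      (braid B ?X ?Y \<otimes> ide ?Z)"
    by (simp add: tens_cmp_left[symmetric] wbraid_merge cmp_assoc')
  also have "\<dots> = (und (wid B ys \<boxtimes> wbraid B xs zs) \<cdot> merge B ys (xs @ zs)) \<cdot> (ide ?Y \<otimes> merge B xs zs) \<cdot>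
      asc B ?Y ?X ?Z \<cdot> (braid B ?X ?Y \<otimes> ide ?Z)"
    by (simp add: merge_assoc cmp_assoc')
  also have "\<dots> = merge B ys (zs @ xs) \<cdot> ((ide ?Y \<otimes> und (wbraid B xs zs)) \<cdot> (ide ?Y \<otimes> merge B xs zs)) \<cdot>
      asc B ?Y ?X ?Z \<cdot> (braid B ?X ?Y \<otimes> ide ?Z)"
    using wtens_merge[of "wid B ys" "wbraid B xs zs"] by (simp add: cmp_assoc')
  also have "(ide ?Y \<otimes> und (wbraid B xs zs)) \<cdot> (ide ?Y \<otimes> merge B xs zs) =
      (ide ?Y \<otimes> merge B zs xs) \<cdot> (ide ?Y \<otimes> braid B ?X ?Z)"
    by (simp add: tens_cmp_right[symmetric] wbraid_merge)
  also have "merge B ys (zs @ xs) \<cdot> \<dots> \<cdot> asc B ?Y ?X ?Z \<cdot> (braid B ?X ?Y \<otimes> ide ?Z) =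
      (merge B ys (zs @ xs) \<cdot> (ide ?Y \<otimes> merge B zs xs) \<cdot> asc B ?Y ?Z ?X) \<cdot> braid B ?X (?Y \<odot> ?Z) \<cdot> asc B ?X ?Y ?Z"
    using hexagon_right[of ?X ?Y ?Z] by (simp add: cmp_assoc')
  also have "\<dots> = ?r"
    by (simp add: merge_assoc[symmetric] cmp_assoc')
  finally show "und (wbraid B xs (ys @ zs)) \<cdot> ?k =
      und ((wid B ys \<boxtimes> wbraid B xs zs) \<bullet> (wbraid B xs ys \<boxtimes> wid B zs)) \<cdot> ?k"
    using 1 by simp
qed simp_all

lemma wbraid_append_left:
  assumes [simp]: "objs xs" "objs ys" "objs zs"
  shows "wbraid B (xs @ ys) zs = (wbraid B xs zs \<boxtimes> wid B ys) \<bullet> (wid B xs \<boxtimes> wbraid B ys zs)"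
proof (rule warr_eqI)
  let ?X = "wo xs" and ?Y = "wo ys" and ?Z = "wo zs"
  let ?k = "merge B xs (ys @ zs) \<cdot> (ide ?X \<otimes> merge B ys zs)"
  let ?r = "merge B zs (xs @ ys) \<cdot> (ide ?Z \<otimes> merge B xs ys) \<cdot> braid B (?X \<odot> ?Y) ?Z \<cdot> ainv (asc B ?X ?Y ?Z)"
  have "und (wbraid B (xs @ ys) zs) \<cdot> ?k =
      (und (wbraid B (xs @ ys) zs) \<cdot> merge B (xs @ ys) zs) \<cdot> (merge B xs ys \<otimes> ide ?Z) \<cdot> ainv (asc B ?X ?Y ?Z)"
    by (simp add: merge_assoc'[symmetric] cmp_assoc')
  also have "\<dots> = merge B zs (xs @ ys) \<cdot> (braid B (wo (xs @ ys)) ?Z \<cdot> (merge B xs ys \<otimes> ide ?Z)) \<cdot> ainv (asc B ?X ?Y ?Z)"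
    using wbraid_merge[of "xs @ ys" zs] by (simp add: cmp_assoc')
  also have "\<dots> = ?r"
    using braid_nat[of "merge B xs ys" "ide ?Z"] by (simp add: cmp_assoc')
  finally have 1: "und (wbraid B (xs @ ys) zs) \<cdot> ?k = ?r" .
  have "und ((wbraid B xs zs \<boxtimes> wid B ys) \<bullet> (wid B xs \<boxtimes> wbraid B ys zs)) \<cdot> ?k =
      und (wbraid B xs zs \<boxtimes> wid B ys) \<cdot> (und (wid B xs \<boxtimes> wbraid B ys zs) \<cdot> merge B xs (ys @ zs)) \<cdot>
      (ide ?X \<otimes> merge B ys zs)"
    by (simp add: cmp_assoc')
  also have "\<dots> = und (wbraid B xs zs \<boxtimes> wid B ys) \<cdot> merge B xs (zs @ ys) \<cdot>
      (ide ?X \<otimes> und (wbraid B ys zs)) \<cdot> (ide ?X \<otimes> merge B ys zs)"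
    using wtens_merge[of "wid B xs" "wbraid B ys zs"] by (simp add: cmp_assoc')
  also have "\<dots> = und (wbraid B xs zs \<boxtimes> wid B ys) \<cdot> (merge B xs (zs @ ys) \<cdot> (ide ?X \<otimes> merge B zs ys)) \<cdot>
      (ide ?X \<otimes> braid B ?Y ?Z)"
    by (simp add: tens_cmp_right[symmetric] wbraid_merge cmp_assoc')
  also have "\<dots> = (und (wbraid B xs zs \<boxtimes> wid B ys) \<cdot> merge B (xs @ zs) ys) \<cdot> (merge B xs zs \<otimes> ide ?Y) \<cdot>
      ainv (asc B ?X ?Z ?Y) \<cdot> (ide ?X \<otimes> braid B ?Y ?Z)"
    by (simp add: merge_assoc'[symmetric] cmp_assoc')
  also have "\<dots> = merge B (zs @ xs) ys \<cdot> ((und (wbraid B xs zs) \<otimes> ide ?Y) \<cdot> (merge B xs zs \<otimes> ide ?Y)) \<cdot>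
      ainv (asc B ?X ?Z ?Y) \<cdot> (ide ?X \<otimes> braid B ?Y ?Z)"
    using wtens_merge[of "wbraid B xs zs" "wid B ys"] by (simp add: cmp_assoc')
  also have "(und (wbraid B xs zs) \<otimes> ide ?Y) \<cdot> (merge B xs zs \<otimes> ide ?Y) =
      (merge B zs xs \<otimes> ide ?Y) \<cdot> (braid B ?X ?Z \<otimes> ide ?Y)"
    by (simp add: tens_cmp_left[symmetric] wbraid_merge)
  also have "merge B (zs @ xs) ys \<cdot> \<dots> \<cdot> ainv (asc B ?X ?Z ?Y) \<cdot> (ide ?X \<otimes> braid B ?Y ?Z) =
      (merge B (zs @ xs) ys \<cdot> (merge B zs xs \<otimes> ide ?Y) \<cdot> ainv (asc B ?Z ?X ?Y)) \<cdot>
      braid B (?X \<odot> ?Y) ?Z \<cdot> ainv (asc B ?X ?Y ?Z)"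
    using hexagon_left[of ?X ?Y ?Z] by (simp add: cmp_assoc')
  also have "\<dots> = ?r"
    by (simp add: merge_assoc' cmp_assoc')
  finally show "und (wbraid B (xs @ ys) zs) \<cdot> ?k =
      und ((wbraid B xs zs \<boxtimes> wid B ys) \<bullet> (wid B xs \<boxtimes> wbraid B ys zs)) \<cdot> ?k"
    using 1 by simp
qed simp_all

text \<open>With two empty words the hexagon makes this braiding idempotent; being invertible, it is
  the identity.\<close>

lemma wbraid_Nil_left:
  assumes [simp]: "objs xs"
  shows "wbraid B [] xs = wid B xs"
proof (rule warr_eqI)
  have "wbraid B [] xs \<bullet> wbraid B [] xs = wbraid B [] xs"
    using wbraid_append_left[of "[]" "[]" xs] by (simp add: wtens_Nil_left wtens_Nil_right)
  then have "und (wbraid B [] xs) \<cdot> und (wbraid B [] xs) = und (wbraid B [] xs)"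
    by (metis wcmp_typed(3))
  then show "und (wbraid B [] xs) \<cdot> und (wbraid B [] xs) = und (wid B xs) \<cdot> und (wbraid B [] xs)"
    by simp
qed simp_all

lemma wbraid_Nil_right:
  assumes [simp]: "objs xs"
  shows "wbraid B xs [] = wid B xs"
proof (rule warr_eqI)
  have "wbraid B xs [] \<bullet> wbraid B xs [] = wbraid B xs []"
    using wbraid_append_right[of xs "[]" "[]"] by (simp add: wtens_Nil_left wtens_Nil_right)
  then have "und (wbraid B xs []) \<cdot> und (wbraid B xs []) = und (wbraid B xs [])"
    by (metis wcmp_typed(3))
  then show "und (wbraid B xs []) \<cdot> und (wbraid B xs []) = und (wid B xs) \<cdot> und (wbraid B xs [])"
    by simp
qed simp_all

end

section \<open>Germs of arrows\<close>

text \<open>Only tensor powers of one object occur, so an object is recorded by its exponent and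
  tensoring adds exponents.\<close>

locale strict_monoidal_nat =
  fixes Arr :: "'x set"
    and dom cod :: "'x \<Rightarrow> nat"
    and cmp :: "'x \<Rightarrow> 'x \<Rightarrow> 'x"  (infixr "\<diamondop>" 55)
    and tns :: "'x \<Rightarrow> 'x \<Rightarrow> 'x"  (infixr "\<oplus>" 70)
    and idn :: "nat \<Rightarrow> 'x"
  assumes idn [simp]: "idn n \<in> Arr" "dom (idn n) = n" "cod (idn n) = n"
    and cmp [simp]: "\<lbrakk>f \<in> Arr; g \<in> Arr; cod f = dom g\<rbrakk> \<Longrightarrow> g \<diamondop> f \<in> Arr"
      "\<lbrakk>f \<in> Arr; g \<in> Arr; cod f = dom g\<rbrakk> \<Longrightarrow> dom (g \<diamondop> f) = dom f"
      "\<lbrakk>f \<in> Arr; g \<in> Arr; cod f = dom g\<rbrakk> \<Longrightarrow> cod (g \<diamondop> f) = cod g"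
    and tns [simp]: "\<lbrakk>f \<in> Arr; g \<in> Arr\<rbrakk> \<Longrightarrow> f \<oplus> g \<in> Arr"
      "\<lbrakk>f \<in> Arr; g \<in> Arr\<rbrakk> \<Longrightarrow> dom (f \<oplus> g) = dom f + dom g"
      "\<lbrakk>f \<in> Arr; g \<in> Arr\<rbrakk> \<Longrightarrow> cod (f \<oplus> g) = cod f + cod g"
    and cmp_assoc: "\<lbrakk>f \<in> Arr; g \<in> Arr; h \<in> Arr; cod f = dom g; cod g = dom h\<rbrakk>
        \<Longrightarrow> (h \<diamondop> g) \<diamondop> f = h \<diamondop> g \<diamondop> f"
    and idn_left: "\<lbrakk>f \<in> Arr; cod f = n\<rbrakk> \<Longrightarrow> idn n \<diamondop> f = f"
    and idn_right: "\<lbrakk>f \<in> Arr; dom f = n\<rbrakk> \<Longrightarrow> f \<diamondop> idn n = f"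
    and tns_assoc: "\<lbrakk>f \<in> Arr; g \<in> Arr; h \<in> Arr\<rbrakk> \<Longrightarrow> (f \<oplus> g) \<oplus> h = f \<oplus> g \<oplus> h"
    and tns_left: "f \<in> Arr \<Longrightarrow> idn 0 \<oplus> f = f"
    and tns_right: "f \<in> Arr \<Longrightarrow> f \<oplus> idn 0 = f"
    and tns_idn: "idn m \<oplus> idn n = idn (m + n)"
    and tns_cmp: "\<lbrakk>f \<in> Arr; g \<in> Arr; f' \<in> Arr; g' \<in> Arr; cod f = dom g; cod f' = dom g'\<rbrakk>
        \<Longrightarrow> (g \<diamondop> f) \<oplus> (g' \<diamondop> f') = (g \<oplus> g') \<diamondop> (f \<oplus> f')"
begin

text \<open>
  A germ is a class of arrows up to tensoring with identities on the right.  Every arrow acts on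
  germs by composition, with no typing condition; other sets of arrows are left fixed, so that
  the action laws hold without exception.
\<close>

definition same_germ :: "'x \<Rightarrow> 'x \<Rightarrow> bool" where
  "same_germ x y \<longleftrightarrow> x \<in> Arr \<and> y \<in> Arr \<and> (\<exists>k l. x \<oplus> idn k = y \<oplus> idn l)"

definition germ :: "'x \<Rightarrow> 'x set" where
  "germ x = {y. same_germ x y}"

text \<open>The paddings make both interfaces equal to \<open>dom f + cod x\<close>, so that the
  composite exists whatever the types of \<open>f\<close> and \<open>x\<close>.\<close>

definition post :: "'x \<Rightarrow> 'x \<Rightarrow> 'x" where
  "post f x = (f \<oplus> idn (cod x)) \<diamondop> (x \<oplus> idn (dom f))"

definition act :: "'x \<Rightarrow> 'x set \<Rightarrow> 'x set" where
  "act f X = (if X \<in> germ ` Arr then germ (post f (SOME x. x \<in> Arr \<and> X = germ x)) else X)"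

text \<open>
  \<open>at f i\<close> lets \<open>f\<close> act on the tensor factors from position \<open>i\<close> (counted from 0) on.
\<close>

definition at :: "'x \<Rightarrow> nat \<Rightarrow> 'x set \<Rightarrow> 'x set" where
  "at f i = act (idn i \<oplus> f)"

lemma pad [simp]: "x \<in> Arr \<Longrightarrow> (x \<oplus> idn k) \<oplus> idn l = x \<oplus> idn (k + l)"
  by (simp add: tns_assoc tns_idn)

lemma tns_cmp_idn: "\<lbrakk>f \<in> Arr; g \<in> Arr; cod f = dom g\<rbrakk>
    \<Longrightarrow> (g \<diamondop> f) \<oplus> idn k = (g \<oplus> idn k) \<diamondop> (f \<oplus> idn k)"
  using tns_cmp[of f g "idn k" "idn k"] by (simp add: idn_left)

lemma idn_tns_cmp: "\<lbrakk>f \<in> Arr; g \<in> Arr; cod f = dom g\<rbrakk>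
    \<Longrightarrow> idn k \<oplus> (g \<diamondop> f) = (idn k \<oplus> g) \<diamondop> (idn k \<oplus> f)"
  using tns_cmp[of "idn k" "idn k" f g] by (simp add: idn_left)

lemma same_germ_pad: "x \<in> Arr \<Longrightarrow> same_germ x (x \<oplus> idn k)"
  unfolding same_germ_def using pad[of x k 0] by (metis idn(1) tns(1) tns_right)

lemma same_germ_sym: "same_germ x y \<Longrightarrow> same_germ y x"
  unfolding same_germ_def by metis

lemma same_germ_trans: "same_germ x y \<Longrightarrow> same_germ y z \<Longrightarrow> same_germ x z"
  unfolding same_germ_def by (metis pad add.commute)

lemma germ_eq: "x \<in> Arr \<Longrightarrow> y \<in> Arr \<Longrightarrow> germ x = germ y \<longleftrightarrow> same_germ x y"
proof -
  assume "x \<in> Arr" "y \<in> Arr"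
  moreover have "same_germ y y"
    using same_germ_pad[of y 0] \<open>y \<in> Arr\<close> by (simp add: tns_right)
  ultimately show ?thesis
    unfolding germ_def using same_germ_sym same_germ_trans by blast
qed

lemma germ_pad: "x \<in> Arr \<Longrightarrow> germ (x \<oplus> idn k) = germ x"
  by (metis germ_eq idn(1) same_germ_pad tns(1))

lemma post_Arr [simp]: "f \<in> Arr \<Longrightarrow> x \<in> Arr \<Longrightarrow> post f x \<in> Arr"
  "f \<in> Arr \<Longrightarrow> x \<in> Arr \<Longrightarrow> dom (post f x) = dom x + dom f"
  "f \<in> Arr \<Longrightarrow> x \<in> Arr \<Longrightarrow> cod (post f x) = cod f + cod x"
  by (simp_all add: post_def add.commute)

lemma post_pad: "f \<in> Arr \<Longrightarrow> x \<in> Arr \<Longrightarrow> post f x \<oplus> idn k = post f (x \<oplus> idn k)"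
  by (simp add: post_def tns_cmp_idn add.commute)

lemma germ_post:
  assumes "f \<in> Arr" "x \<in> Arr" "y \<in> Arr" "germ x = germ y"
  shows "germ (post f x) = germ (post f y)"
proof -
  obtain k l where "x \<oplus> idn k = y \<oplus> idn l"
    using assms by (auto simp: germ_eq same_germ_def)
  then have "post f x \<oplus> idn k = post f y \<oplus> idn l"
    using assms by (simp add: post_pad)
  then show ?thesis
    using assms by (metis germ_pad post_Arr(1))
qed

lemma act_germ: "f \<in> Arr \<Longrightarrow> x \<in> Arr \<Longrightarrow> act f (germ x) = germ (post f x)"
proof -
  assume *: "f \<in> Arr" "x \<in> Arr"
  let ?y = "SOME y. y \<in> Arr \<and> germ x = germ y"
  have "?y \<in> Arr \<and> germ x = germ ?y"
    by (rule someI[of _ x]) (simp add: *)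
  then show ?thesis
    using * germ_post[of f x ?y] by (simp add: act_def)
qed

lemma act_junk: "X \<notin> germ ` Arr \<Longrightarrow> act f X = X"
  by (simp add: act_def)

lemma act_eqI:
  assumes "\<And>x. x \<in> Arr \<Longrightarrow> F (germ x) = G (germ x)" "\<And>X. X \<notin> germ ` Arr \<Longrightarrow> F X = G X"
  shows "F X = G X"
  using assms by (cases "X \<in> germ ` Arr") auto

lemma act_cmp:
  assumes [simp]: "f \<in> Arr" "g \<in> Arr" "cod f = dom g"
  shows "act (g \<diamondop> f) X = act g (act f X)"
proof (rule act_eqI[where F = "act (g \<diamondop> f)" and G = "\<lambda>X. act g (act f X)"])
  fix x assume [simp]: "x \<in> Arr"
  have "post g (post f x) = post (g \<diamondop> f) x \<oplus> idn (dom g)"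
    by (simp add: post_def tns_cmp_idn cmp_assoc add.commute)
  then show "act (g \<diamondop> f) (germ x) = act g (act f (germ x))"
    by (simp add: act_germ germ_pad)
qed (simp add: act_junk)

lemma act_pad:
  assumes [simp]: "f \<in> Arr"
  shows "act (f \<oplus> idn k) X = act f X"
proof (rule act_eqI[where F = "act (f \<oplus> idn k)"])
  fix x assume [simp]: "x \<in> Arr"
  have "post (f \<oplus> idn k) x = post f x \<oplus> idn k"
    by (simp add: post_def tns_cmp_idn add.commute)
  then show "act (f \<oplus> idn k) (germ x) = act f (germ x)"
    by (simp add: act_germ germ_pad)
qed (simp add: act_junk)

lemma act_idn: "act (idn n) X = X"
proof (rule act_eqI[where F = "act (idn n)" and G = "\<lambda>X. X"])
  fix x assume [simp]: "x \<in> Arr"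
  have "post (idn n) x = x \<oplus> idn n"
    by (simp add: post_def tns_idn idn_left add.commute)
  then show "act (idn n) (germ x) = germ x"
    by (simp add: act_germ germ_pad)
qed (simp add: act_junk)

lemma at_0: "f \<in> Arr \<Longrightarrow> at f 0 = act f"
  by (simp add: at_def tns_left)

lemma at_idn [simp]: "at (idn n) i X = X"
  by (simp add: at_def tns_idn act_idn)

lemma at_cmp: "\<lbrakk>f \<in> Arr; g \<in> Arr; cod f = dom g\<rbrakk> \<Longrightarrow> at (g \<diamondop> f) i X = at g i (at f i X)"
  by (simp add: at_def idn_tns_cmp act_cmp)

lemma tns_split:
  assumes [simp]: "f \<in> Arr" "g \<in> Arr"
  shows "f \<oplus> g = (f \<oplus> idn (cod g)) \<diamondop> (idn (dom f) \<oplus> g)"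
    and "f \<oplus> g = (idn (cod f) \<oplus> g) \<diamondop> (f \<oplus> idn (dom g))"
  using tns_cmp[of "idn (dom f)" f g "idn (cod g)"] tns_cmp[of f "idn (cod f)" "idn (dom g)" g]
  by (simp_all add: idn_left idn_right)

lemma at_tns_idn: "f \<in> Arr \<Longrightarrow> at (f \<oplus> idn k) i X = at f i X"
  by (simp add: at_def tns_assoc[symmetric] act_pad del: pad)

lemma at_idn_tns: "f \<in> Arr \<Longrightarrow> at (idn k \<oplus> f) i X = at f (i + k) X"
  by (simp add: at_def tns_assoc[symmetric] tns_idn)

lemma at_tns: "f \<in> Arr \<Longrightarrow> g \<in> Arr \<Longrightarrow> at (f \<oplus> g) i X = at f i (at g (i + dom f) X)"
  and at_tns': "f \<in> Arr \<Longrightarrow> g \<in> Arr \<Longrightarrow> at (f \<oplus> g) i X = at g (i + cod f) (at f i X)"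
  by (subst tns_split(1), simp_all add: at_cmp at_tns_idn at_idn_tns)
    (subst tns_split(2), simp_all add: at_cmp at_tns_idn at_idn_tns)

text \<open>The interchange law for arrows on disjoint strands: passing \<open>f\<close>, which
  stands to the left, moves \<open>g\<close> by \<open>cod f - dom f\<close> positions.\<close>

lemma at_shift: "f \<in> Arr \<Longrightarrow> g \<in> Arr \<Longrightarrow> i + dom f \<le> j
    \<Longrightarrow> at f i (at g j X) = at g (j - dom f + cod f) (at f i X)"
proof -
  assume *: "f \<in> Arr" "g \<in> Arr" "i + dom f \<le> j"
  define k where "k = j - i - dom f"
  have j: "j = i + dom f + k" using * by (simp add: k_def)
  show ?thesis
    using at_tns[of f "idn k \<oplus> g" i X] at_tns'[of f "idn k \<oplus> g" i X] *
    by (simp add: j at_idn_tns add_ac)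
qed

lemma at_shift': "f \<in> Arr \<Longrightarrow> g \<in> Arr \<Longrightarrow> i + cod f \<le> j
    \<Longrightarrow> at g j (at f i X) = at f i (at g (j - cod f + dom f) X)"
  by (simp add: at_shift)

end

section \<open>Faithfulness of the action on germs\<close>

locale strict_monoidal_nat_faithful = strict_monoidal_nat +
  fixes u e
  assumes unit_counit_typed: "u \<in> Arr" "e \<in> Arr" "dom u = 0" "cod u = 1" "dom e = 1" "cod e = 0"
    and counit_unit: "e \<diamondop> u = idn 0"
begin

text \<open>Putting \<open>u\<close> before and \<open>e\<close> after the extra strand of
  \<open>h \<oplus> idn 1\<close> gives back \<open>h\<close>, so padding strands can be removed one
  at a time.\<close>

lemma tns_idn_inject:
  assumes [simp]: "f \<in> Arr" "g \<in> Arr"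
    and eq: "f \<oplus> idn k = g \<oplus> idn k"
  shows "f = g"
  using eq
proof (induction k)
  case 0
  then show ?case by (simp add: tns_right)
next
  case (Suc k)
  note [simp] = unit_counit_typed
  have *: "h = (idn (cod h) \<oplus> e) \<diamondop> (h \<oplus> idn 1) \<diamondop> (idn (dom h) \<oplus> u)" if [simp]: "h \<in> Arr" for h
  proof -
    have "h = h \<oplus> (e \<diamondop> u)" by (simp add: counit_unit tns_right)
    also have "\<dots> = h \<oplus> (e \<diamondop> idn 1 \<diamondop> u)" by (simp add: idn_left)
    also have "\<dots> = (idn (cod h) \<diamondop> h \<diamondop> idn (dom h)) \<oplus> (e \<diamondop> idn 1 \<diamondop> u)"
      by (simp add: idn_left idn_right)
    also have "\<dots> = (idn (cod h) \<oplus> e) \<diamondop> (h \<oplus> idn 1) \<diamondop> (idn (dom h) \<oplus> u)"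
      by (simp add: tns_cmp del: One_nat_def)
    finally show ?thesis .
  qed
  have "dom (f \<oplus> idn (Suc k)) = dom (g \<oplus> idn (Suc k))"
    "cod (f \<oplus> idn (Suc k)) = cod (g \<oplus> idn (Suc k))"
    using Suc.prems by simp_all
  then have "dom f = dom g" "cod f = cod g" by simp_all
  moreover have "(f \<oplus> idn k) \<oplus> idn 1 = (g \<oplus> idn k) \<oplus> idn 1"
    using Suc.prems by simp
  ultimately have "f \<oplus> idn k = g \<oplus> idn k"
    using *[of "f \<oplus> idn k"] *[of "g \<oplus> idn k"] by (simp del: pad One_nat_def)
  then show ?case by (rule Suc.IH)
qed

text \<open>Acting on the germ of an identity yields the germ of the acting arrow, so the action
  determines the arrow up to padding; equal domains force equal padding, which then cancels.\<close>

lemma at_eqD: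
  assumes [simp]: "f \<in> Arr" "g \<in> Arr" "dom f = dom g" "cod f = cod g"
    and "\<And>X. at f 0 X = at g 0 X"
  shows "f = g"
proof -
  have act: "act h (germ (idn n)) = germ h" if [simp]: "h \<in> Arr" "dom h = n" for h n
  proof -
    have "post h (idn n) = h \<oplus> idn n"
      by (simp add: post_def tns_idn idn_right)
    then show ?thesis by (simp add: act_germ germ_pad)
  qed
  have "germ f = germ g"
    using assms(5)[of "germ (idn (dom f))"] by (simp add: at_0 act)
  then obtain k l where kl: "f \<oplus> idn k = g \<oplus> idn l"
    by (auto simp: germ_eq same_germ_def)
  then have "dom (f \<oplus> idn k) = dom (g \<oplus> idn l)" by simp
  then have "k = l" by simp
  with kl show ?thesis by (auto intro: tns_idn_inject)
qed

end

section \<open>Hopf algebras in a strict braided category\<close>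

locale braided_nat = strict_monoidal_nat Arr dom cod cmp tns idn
  for Arr :: "'x set"
    and dom cod :: "'x \<Rightarrow> nat"
    and cmp :: "'x \<Rightarrow> 'x \<Rightarrow> 'x"  (infixr "\<diamondop>" 55)
    and tns :: "'x \<Rightarrow> 'x \<Rightarrow> 'x"  (infixr "\<oplus>" 70)
    and idn :: "nat \<Rightarrow> 'x" +
  fixes br :: "nat \<Rightarrow> nat \<Rightarrow> 'x"
  assumes br [simp]: "br p q \<in> Arr" "dom (br p q) = p + q" "cod (br p q) = q + p"
    and br_natural: "\<lbrakk>f \<in> Arr; g \<in> Arr\<rbrakk>
        \<Longrightarrow> br (cod f) (cod g) \<diamondop> (f \<oplus> g) = (g \<oplus> f) \<diamondop> br (dom f) (dom g)"
    and br_hexagon_right: "br p (q + r) = (idn q \<oplus> br p r) \<diamondop> (br p q \<oplus> idn r)"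
    and br_hexagon_left: "br (p + q) r = (br p r \<oplus> idn q) \<diamondop> (idn p \<oplus> br q r)"
    and br_0_left [simp]: "br 0 n = idn n"
    and br_0_right [simp]: "br n 0 = idn n"
begin

lemma at_br_left: "f \<in> Arr \<Longrightarrow> at (br (cod f) n) i (at f i x) = at f (i + n) (at (br (dom f) n) i x)"
  using br_natural[of f "idn n"] at_cmp[of "f \<oplus> idn n" "br (cod f) n" i x]
    at_cmp[of "br (dom f) n" "idn n \<oplus> f" i x]
  by (simp add: at_tns_idn at_idn_tns)

lemma at_br_right: "f \<in> Arr \<Longrightarrow> at (br n (cod f)) i (at f (i + n) x) = at f i (at (br n (dom f)) i x)"
  using br_natural[of "idn n" f] at_cmp[of "idn n \<oplus> f" "br n (cod f)" i x]
    at_cmp[of "br n (dom f)" "f \<oplus> idn n" i x]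
  by (simp add: at_tns_idn at_idn_tns)

lemma at_br_add_right: "at (br p (q + r)) i x = at (br p r) (i + q) (at (br p q) i x)"
  by (simp add: br_hexagon_right at_cmp at_tns_idn at_idn_tns)

lemma at_br_add_left: "at (br (p + q) r) i x = at (br p r) i (at (br q r) (i + p) x)"
  by (simp add: br_hexagon_left at_cmp at_tns_idn at_idn_tns)

abbreviation "C \<equiv> at (br (Suc 0) (Suc 0))"

lemma at_br_1_2: "at (br (Suc 0) (Suc (Suc 0))) i x = C (Suc i) (C i x)"
  using at_br_add_right[of "Suc 0" "Suc 0" "Suc 0"] by simp

lemma at_br_2_1: "at (br (Suc (Suc 0)) (Suc 0)) i x = C i (C (Suc i) x)"
  using at_br_add_left[of "Suc 0" "Suc 0" "Suc 0"] by simp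

lemma C_mul:
  assumes "f \<in> Arr" "dom f = 2" "cod f = 1"
  shows "C i (at f i x) = at f (Suc i) (C i (C (Suc i) x))"
    and "C i (at f (Suc i) x) = at f i (C (Suc i) (C i x))"
  using assms at_br_left[of f 1 i x] at_br_right[of f 1 i x]
  by (simp_all add: at_br_1_2 at_br_2_1 numeral_2_eq_2)

lemma C_comul:
  assumes "f \<in> Arr" "dom f = 1" "cod f = 2"
  shows "at f (Suc i) (C i x) = C i (C (Suc i) (at f i x))"
    and "at f i (C i x) = C (Suc i) (C i (at f (Suc i) x))"
  using assms at_br_left[of f 1 i x] at_br_right[of f 1 i x]
  by (simp_all add: at_br_1_2 at_br_2_1 numeral_2_eq_2)

lemma C_unit:
  assumes "f \<in> Arr" "dom f = 0" "cod f = 1"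
  shows "C i (at f i x) = at f (Suc i) x"
    and "C i (at f (Suc i) x) = at f i x"
  using assms at_br_left[of f 1 i x] at_br_right[of f 1 i x] by simp_all

lemma C_counit:
  assumes "f \<in> Arr" "dom f = 1" "cod f = 0"
  shows "at f (Suc i) (C i x) = at f i x"
    and "at f i (C i x) = at f (Suc i) x"
  using assms at_br_left[of f 1 i x] at_br_right[of f 1 i x] by simp_all

lemma C_endo:
  assumes "f \<in> Arr" "dom f = 1" "cod f = 1"
  shows "C i (at f i x) = at f (Suc i) (C i x)"
    and "C i (at f (Suc i) x) = at f i (C i x)"
  using assms at_br_left[of f 1 i x] at_br_right[of f 1 i x] by simp_all

end

locale hopf_nat = strict_monoidal_nat_faithful Arr dom cod cmp tns idn u e +
    braided_nat Arr dom cod cmp tns idn br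
  for Arr :: "'x set"
    and dom cod :: "'x \<Rightarrow> nat"
    and cmp :: "'x \<Rightarrow> 'x \<Rightarrow> 'x"  (infixr "\<diamondop>" 55)
    and tns :: "'x \<Rightarrow> 'x \<Rightarrow> 'x"  (infixr "\<oplus>" 70)
    and idn :: "nat \<Rightarrow> 'x"
    and br :: "nat \<Rightarrow> nat \<Rightarrow> 'x"
    and u e :: 'x +
  fixes m d s :: 'x
  assumes struct_typed [simp]: "m \<in> Arr" "d \<in> Arr" "s \<in> Arr" "dom m = 2" "cod m = 1" "dom d = 1"
      "cod d = 2" "dom s = 1" "cod s = 1"
    and m_assoc: "m \<diamondop> (m \<oplus> idn 1) = m \<diamondop> (idn 1 \<oplus> m)"
    and m_unit: "m \<diamondop> (u \<oplus> idn 1) = idn 1" "m \<diamondop> (idn 1 \<oplus> u) = idn 1"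
    and d_coassoc: "(d \<oplus> idn 1) \<diamondop> d = (idn 1 \<oplus> d) \<diamondop> d"
    and d_counit: "(e \<oplus> idn 1) \<diamondop> d = idn 1" "(idn 1 \<oplus> e) \<diamondop> d = idn 1"
    and d_m: "d \<diamondop> m = (m \<oplus> m) \<diamondop> (idn 1 \<oplus> br 1 1 \<oplus> idn 1) \<diamondop> (d \<oplus> d)"
    and d_u: "d \<diamondop> u = u \<oplus> u"
    and e_m: "e \<diamondop> m = e \<oplus> e"
    and m_s_d: "m \<diamondop> (s \<oplus> idn 1) \<diamondop> d = u \<diamondop> e" "m \<diamondop> (idn 1 \<oplus> s) \<diamondop> d = u \<diamondop> e"
begin

section \<open>Structure equations and the antipode\<close>

abbreviation "M \<equiv> at m"
abbreviation "D \<equiv> at d"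
abbreviation "U \<equiv> at u"
abbreviation "E \<equiv> at e"
abbreviation "S \<equiv> at s"

declare unit_counit_typed [simp]

lemma at_cong: "f = g \<Longrightarrow> at f i x = at g i x"
  by simp

lemmas at_expand = at_cmp at_tns_idn at_idn_tns at_tns

lemma at_m_assoc: "M i (M (Suc i) x) = M i (M i x)"
  using at_cong[OF m_assoc, of i x] by (simp add: at_expand)

lemma at_m_unit: "M i (U i x) = x" "M i (U (Suc i) x) = x"
  using at_cong[OF m_unit(1), of i x] at_cong[OF m_unit(2), of i x] by (simp_all add: at_expand)

lemma at_d_coassoc: "D (Suc i) (D i x) = D i (D i x)"
  using at_cong[OF d_coassoc, of i x] by (simp add: at_expand)

lemma at_d_counit: "E i (D i x) = x" "E (Suc i) (D i x) = x"
  using at_cong[OF d_counit(1), of i x] at_cong[OF d_counit(2), of i x] by (simp_all add: at_expand)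

lemma at_d_m: "D i (M i x) = M i (M (Suc (Suc i)) (C (Suc i) (D i (D (Suc i) x))))"
  using at_cong[OF d_m, of i x] by (simp add: at_expand)

lemma at_d_u: "D i (U i x) = U i (U i x)"
  using at_cong[OF d_u, of i x] by (simp add: at_expand)

lemma at_e_m: "E i (M i x) = E i (E i x)"
  using at_cong[OF e_m, of i x] by (simp add: at_expand at_shift)

lemma at_e_u: "E i (U i x) = x"
  using at_cong[OF counit_unit, of i x] by (simp add: at_expand)

lemma at_m_s_d: "M i (S i (D i x)) = U i (E i x)" "M i (S (Suc i) (D i x)) = U i (E i x)"
  using at_cong[OF m_s_d(1), of i x] at_cong[OF m_s_d(2), of i x] by (simp_all add: at_expand)

text \<open>\<open>shift_u\<close> moves units outward and \<open>shift_e\<close> moves counits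
  inward, each until it meets an operator on its own strand, where a structure equation or
  naturality applies.\<close>

lemmas shift_u = at_shift'[of u] at_shift[of m u] at_shift[of d u] at_shift[of s u] at_shift[of e u]
  at_shift[of "br p q" u for p q]
lemmas shift_e = at_shift[of e] at_shift'[of m e] at_shift'[of d e] at_shift'[of s e] at_shift'[of u e]
  at_shift'[of "br p q" e for p q]

lemmas hopf_rules = at_m_unit at_d_counit at_d_u at_e_m at_e_u at_m_s_d
lemmas C_rules = C_mul[of m] C_comul[of d] C_unit[of u] C_counit[of e] C_endo[of s]

text \<open>
  In Sweedler notation: \<open>S(h\<^sub>1 a) h\<^sub>2 = \<epsilon>(h) S(a)\<close>.  Multiplying by \<open>a\<^sub>2 S(a\<^sub>3)\<close> on the right
  reduces this to the antipode axiom for \<open>h a\<close>.  Anti-multiplicativity of \<open>S\<close> follows by computing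
  \<open>S(h\<^sub>1 a) h\<^sub>2 S(h\<^sub>3)\<close> in two ways, with no appeal to uniqueness of convolution inverses.
\<close>

lemma antipode_cancel: "M i (S i (M i (C (Suc i) (D i x)))) = S i (E i x)"
proof -
  define X where "X j y = M j (S j (M j (C (Suc j) (D j y))))" for j y
  have X_shift: "at f (Suc i) (X i y) = X i (at f (Suc (Suc i)) y)" if "f \<in> Arr" for f y
    using that by (simp add: X_def at_shift)
  have *: "M i (X i (D (Suc i) y)) = U i (E i (E i y))" for y
  proof -
    have "M i (X i (D (Suc i) y)) = M i (M (Suc i) (S i (M i (C (Suc i) (D i (D (Suc i) y))))))"
      by (simp add: X_def at_m_assoc)
    also have "\<dots> = M i (S i (D i (M i y)))"
      by (simp add: at_d_m at_shift)
    also have "\<dots> = U i (E i (E i y))"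
      by (simp add: hopf_rules)
    finally show ?thesis .
  qed
  have "X i x = M i (U (Suc i) (E (Suc i) (X i (D (Suc i) x))))"
    by (simp add: X_shift[of e] at_m_unit at_d_counit)
  also have "\<dots> = M i (M (Suc i) (S (Suc (Suc i)) (D (Suc i) (X i (D (Suc i) x)))))"
    by (simp add: at_m_s_d)
  also have "\<dots> = M i (S (Suc i) (M i (X i (D (Suc (Suc i)) (D (Suc i) x)))))"
    by (simp add: at_m_assoc at_shift X_shift)
  also have "\<dots> = M i (S (Suc i) (M i (X i (D (Suc i) (D (Suc i) x)))))"
    by (simp add: at_d_coassoc)
  also have "\<dots> = S i (E i x)"
    by (simp add: * hopf_rules shift_u shift_e)
  finally show ?thesis by (simp add: X_def)
qed

lemma antipode_mul: "S i (M i x) = M i (S i (S (Suc i) (C i x)))"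
proof -
  let ?W = "M i (S (Suc i) (M i (S i (M i (C (Suc i) (D i (C (Suc i) (D i x))))))))"
  have "M i (S (Suc i) (S i (E i (C (Suc i) (D i x))))) = M i (S i (S (Suc i) (C i x)))"
    by (simp add: at_shift C_rules hopf_rules)
  then have *: "?W = M i (S i (S (Suc i) (C i x)))"
    by (simp only: antipode_cancel)
  have "?W = M i (M i (S (Suc (Suc i)) (S i (M i (C (Suc i) (C (Suc (Suc i)) (D i (D i x))))))))"
    by (simp add: at_shift C_rules)
  also have "\<dots> = M i (M (Suc i) (S (Suc (Suc i)) (S i (M i (C (Suc i) (C (Suc (Suc i)) (D (Suc i) (D i x))))))))"
    by (simp add: at_m_assoc at_d_coassoc)
  also have "\<dots> = M i (S i (M i (M (Suc (Suc i)) (S (Suc (Suc (Suc i))) (D (Suc (Suc i)) (C (Suc i) (D i x)))))))"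
    by (simp add: at_shift C_rules)
  also have "\<dots> = M i (U (Suc i) (S i (M i (E (Suc (Suc i)) (C (Suc i) (D i x))))))"
    by (simp add: hopf_rules at_shift)
  also have "\<dots> = S i (M i x)"
    by (simp add: hopf_rules at_shift C_rules)
  finally show ?thesis using * by simp
qed

text \<open>The proofs of this lemma and of the next are those above with all diagrams turned upside down.\<close>

lemma antipode_cancel_dual: "M i (C (Suc i) (D i (S i (D i x)))) = U i (S i x)"
proof -
  define X where "X j y = M j (C (Suc j) (D j (S j (D j y))))" for j y
  have X_shift: "X i (at f (Suc i) y) = at f (Suc (Suc i)) (X i y)"
    if "f \<in> Arr" for f y
    using that by (simp add: X_def at_shift)
  have *: "M (Suc i) (X i (D i y)) = U i (U i (E i y))" for y
  proof -
    have "M (Suc i) (X i (D i y)) = M (Suc i) (M i (C (Suc i) (D i (S i (D (Suc i) (D i y))))))"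
      by (simp add: X_def at_d_coassoc)
    also have "\<dots> = M i (M (Suc (Suc i)) (C (Suc i) (D i (D (Suc i) (S i (D i y))))))"
      by (simp add: at_shift)
    also have "\<dots> = D i (M i (S i (D i y)))"
      by (simp add: at_d_m)
    also have "\<dots> = U i (U i (E i y))"
      by (simp add: hopf_rules)
    finally show ?thesis .
  qed
  have "X i x = M (Suc i) (X i (U (Suc i) (E (Suc i) (D i x))))"
    by (simp add: X_shift at_m_unit at_d_counit)
  also have "\<dots> = M (Suc i) (X i (M (Suc i) (S (Suc (Suc i)) (D (Suc i) (D i x)))))"
    by (simp add: at_m_s_d)
  also have "\<dots> = M (Suc i) (M (Suc i) (X i (D i (S (Suc i) (D i x)))))"
    by (simp add: at_d_coassoc X_shift at_shift at_m_assoc[symmetric])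
  also have "\<dots> = U i (S i x)"
    by (simp add: * hopf_rules shift_u shift_e)
  finally show ?thesis by (simp add: X_def)
qed

lemma antipode_comul: "D i (S i x) = C i (S i (S (Suc i) (D i x)))"
proof -
  let ?W = "M i (C (Suc i) (M i (C (Suc i) (D i (S i (D i (S (Suc i) (D i x))))))))"
  have *: "?W = C i (S i (S (Suc i) (D i x)))"
    by (simp only: antipode_cancel_dual) (simp add: shift_u C_rules hopf_rules)
  have "?W = M i (M i (C (Suc (Suc i)) (C (Suc i) (D i (S i (S (Suc (Suc i)) (D i (D i x))))))))"
    by (simp add: at_shift)
  also have "\<dots> = M i (M (Suc i) (C (Suc (Suc i)) (C (Suc i) (D i (S i (S (Suc (Suc i)) (D (Suc i) (D i x))))))))"
    by (simp only: at_m_assoc at_d_coassoc)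
  also have "\<dots> = M i (C (Suc i) (D i (M (Suc i) (S (Suc (Suc i)) (D (Suc i) (S i (D i x)))))))"
    by (simp add: at_shift C_rules)
  also have "\<dots> = M i (C (Suc i) (D i (U (Suc i) (S i (E (Suc i) (D i x))))))"
    by (simp add: hopf_rules shift_e)
  also have "\<dots> = D i (S i x)"
    by (simp add: hopf_rules shift_u shift_e C_rules)
  finally show ?thesis using * by simp
qed

lemma counit_antipode: "E i (S i x) = E i x"
proof -
  have "E i x = E i (M i (S i (D i x)))"
    by (simp add: hopf_rules)
  also have "\<dots> = E i (S i (E (Suc i) (D i x)))"
    by (simp add: at_e_m at_shift)
  finally show ?thesis by (simp add: hopf_rules)
qed

subsection \<open>The diagonal action\<close>

primrec lam :: "nat \<Rightarrow> 'x" where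
  "lam 0 = e"
| "lam (Suc n) = (m \<oplus> lam n) \<diamondop> (idn 1 \<oplus> br 1 1 \<oplus> idn n) \<diamondop> (d \<oplus> idn (Suc n))"

abbreviation "L n \<equiv> at (lam n)"
abbreviation "Br p q \<equiv> at (br p q)"

lemma lam_typed [simp]: "lam n \<in> Arr" "dom (lam n) = Suc n" "cod (lam n) = n"
  by (induction n) simp_all

lemma at_lam_Suc: "L (Suc n) i x = M i (L n (Suc (Suc i)) (C (Suc i) (D i x)))"
  by (simp add: at_expand numeral_2_eq_2)

declare lam.simps(2) [simp del]

lemma at_br_Suc_left': "Br (Suc p) (Suc 0) i x = Br p (Suc 0) i (C (i + p) x)"
  using at_br_add_left[of p "Suc 0" "Suc 0" i x] by simp

lemma at_br_Suc_right: "Br (Suc 0) (Suc p) i x = Br (Suc 0) p (Suc i) (C i x)"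
  using at_br_add_right[of "Suc 0" "Suc 0" p i x] by simp

lemma at_br_Suc_right': "Br (Suc 0) (Suc p) i x = C (i + p) (Br (Suc 0) p i x)"
  using at_br_add_right[of "Suc 0" p "Suc 0" i x] by simp

text \<open>For h acting after g, distributing both over the factors makes h2 cross g1; this is
  exactly the crossing in \<open>d_m\<close>, which folds the two actions into one.\<close>

lemma lam_mul: "L n i (L n (Suc i) x) = L n i (M i x)"
proof (induction n arbitrary: i x)
  case 0
  then show ?case by (simp add: at_e_m at_shift)
next
  case (Suc n)
  have "L (Suc n) i (L (Suc n) (Suc i) x) = M i (M i (L n (Suc (Suc (Suc i))) (L n (Suc (Suc (Suc (Suc i))))
      (C (Suc (Suc i)) (C (Suc i) (C (Suc (Suc (Suc i))) (D i (D (Suc i) x))))))))"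
    by (simp add: at_lam_Suc at_shift C_rules at_m_assoc)
  also have "\<dots> = L (Suc n) i (M i x)"
    by (simp add: Suc.IH at_lam_Suc at_shift C_rules at_d_m)
  finally show ?case .
qed

text \<open>In Sweedler notation S(h1 a).(h2.v) = (S(h1 a) h2).v = epsilon(h) S(a).v: letting S of
  the first factor of h.(a \<otimes> v) act on the others undoes the action of h.\<close>

lemma lam_antipode_lam: "L n i (S i (L (Suc n) i x)) = L n i (S i (E i x))"
proof -
  have "L n i (S i (L (Suc n) i x)) = L n i (L n (Suc i) (S i (M i (C (Suc i) (D i x)))))"
    by (simp add: at_lam_Suc at_shift)
  also have "\<dots> = L n i (S i (E i x))"
    by (simp add: lam_mul antipode_cancel)
  finally show ?thesis .
qed

text \<open>Multiplicativity of the coproduct makes comultiplying the first factor linear for the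
  diagonal action.\<close>

lemma comul_lam: "D i (L (Suc n) i x) = L (Suc (Suc n)) i (D (Suc i) x)"
  by (simp add: at_lam_Suc at_d_m at_shift C_rules at_d_coassoc)

text \<open>By coassociativity the action may be cut after any \<open>n\<close> factors: h1 acts on
  the first block, and \<open>Br\<close> carries h2 across it to the second.\<close>

lemma lam_add: "L (n + k) i x = L n i (L k (Suc (i + n)) (Br (Suc 0) n (Suc i) (D i x)))"
proof (induction n arbitrary: i x)
  case 0
  then show ?case by (simp add: hopf_rules shift_e)
next
  case (Suc n)
  have "L (Suc n + k) i x = M i (L n (Suc (Suc i)) (L k (Suc (Suc (Suc (i + n))))
      (Br (Suc 0) n (Suc (Suc (Suc i))) (D (Suc (Suc i)) (C (Suc i) (D i x))))))"
    by (simp add: at_lam_Suc Suc.IH)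
  also have "\<dots> = L (Suc n) i (L k (Suc (i + Suc n)) (Br (Suc 0) (Suc n) (Suc i) (D i x)))"
    by (simp add: at_lam_Suc at_shift C_rules at_d_coassoc at_br_Suc_right[of n])
  finally show ?case .
qed

section \<open>Tensor powers and iterates\<close>

primrec tpow :: "'x \<Rightarrow> nat \<Rightarrow> 'x" where
  "tpow f 0 = idn 0"
| "tpow f (Suc n) = f \<oplus> tpow f n"

primrec cpow :: "'x \<Rightarrow> nat \<Rightarrow> 'x" where
  "cpow f 0 = idn (dom f)"
| "cpow f (Suc n) = f \<diamondop> cpow f n"

lemma tpow_typed [simp]:
  assumes "f \<in> Arr" "dom f = 1" "cod f = 1"
  shows "tpow f n \<in> Arr" "dom (tpow f n) = n" "cod (tpow f n) = n"
  using assms by (induction n) simp_all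

lemma cpow_typed [simp]:
  assumes "f \<in> Arr" "dom f = cod f"
  shows "cpow f n \<in> Arr" "dom (cpow f n) = cod f" "cod (cpow f n) = cod f"
  using assms by (induction n) simp_all

declare tpow.simps [simp del] cpow.simps [simp del]

lemma at_tpow_0 [simp]: "at (tpow f 0) i x = x"
  by (simp add: tpow.simps)

lemma at_tpow_Suc:
  assumes "f \<in> Arr" "dom f = 1" "cod f = 1"
  shows "at (tpow f (Suc n)) i x = at f i (at (tpow f n) (Suc i) x)"
    and "at (tpow f (Suc n)) i x = at (tpow f n) i (at f (i + n) x)"
proof -
  show *: "at (tpow f (Suc n)) i x = at f i (at (tpow f n) (Suc i) x)" for n i x
    using assms by (simp add: at_expand tpow.simps)
  show "at (tpow f (Suc n)) i x = at (tpow f n) i (at f (i + n) x)"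
    by (induction n arbitrary: i) (simp_all add: * assms)
qed

lemma at_cpow:
  assumes "f \<in> Arr" "dom f = cod f"
  shows "at (cpow f n) i x = (at f i ^^ n) x"
  using assms by (induction n) (simp_all add: at_expand cpow.simps)

end

section \<open>Modular pairs\<close>

locale modular_nat = hopf_nat Arr dom cod cmp tns idn br u e m d s
  for Arr :: "'x set"
    and dom cod :: "'x \<Rightarrow> nat"
    and cmp :: "'x \<Rightarrow> 'x \<Rightarrow> 'x"  (infixr "\<diamondop>" 55)
    and tns :: "'x \<Rightarrow> 'x \<Rightarrow> 'x"  (infixr "\<oplus>" 70)
    and idn :: "nat \<Rightarrow> 'x"
    and br :: "nat \<Rightarrow> nat \<Rightarrow> 'x"
    and u e m d s :: 'x +
  fixes p q :: 'x
  assumes pair_typed [simp]: "p \<in> Arr" "q \<in> Arr" "dom p = 1" "cod p = 0" "dom q = 0" "cod q = 1"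
    and p_m: "p \<diamondop> m = p \<oplus> p"
    and p_u: "p \<diamondop> u = idn 0"
    and d_q: "d \<diamondop> q = q \<oplus> q"
    and e_q: "e \<diamondop> q = idn 0"
    and p_q: "p \<diamondop> q = idn 0"
begin

abbreviation "P \<equiv> at p"
abbreviation "Q \<equiv> at q"

lemma at_p_m: "P i (M i x) = P i (P i x)"
  using at_cong[OF p_m, of i x] by (simp add: at_expand at_shift)

lemma at_p_u: "P i (U i x) = x"
  using at_cong[OF p_u, of i x] by (simp add: at_expand)

lemma at_d_q: "D i (Q i x) = Q i (Q i x)"
  using at_cong[OF d_q, of i x] by (simp add: at_expand)

lemma at_e_q: "E i (Q i x) = x"
  using at_cong[OF e_q, of i x] by (simp add: at_expand)

lemma at_p_q: "P i (Q i x) = x"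
  using at_cong[OF p_q, of i x] by (simp add: at_expand)

section \<open>Coactions by delta\<close>

text \<open>
  \<open>pl\<close> and \<open>pr\<close> are the one-sided coactions \<open>\<delta>(h\<^sub>1) h\<^sub>2\<close> and \<open>h\<^sub>1 \<delta>(S h\<^sub>2)\<close>; thus the twisted antipode
  \<open>tw\<close> is \<open>S\<close> after \<open>pl\<close>, and \<open>phi\<close>, the paper's \<open>\<phi>\<^sub>\<delta>\<close>, is \<open>pl\<close> after \<open>pr\<close>.
\<close>

definition "pl = (p \<oplus> idn 1) \<diamondop> d"
definition "ps = p \<diamondop> s"
definition "pr = (idn 1 \<oplus> ps) \<diamondop> d"
definition "tw = (p \<oplus> s) \<diamondop> d"
definition "phi = (p \<oplus> idn 1 \<oplus> ps) \<diamondop> (d \<oplus> idn 1) \<diamondop> d"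

lemma pair_derived_typed [simp]:
  "pl \<in> Arr" "dom pl = 1" "cod pl = 1" "ps \<in> Arr" "dom ps = 1" "cod ps = 0"
  "pr \<in> Arr" "dom pr = 1" "cod pr = 1" "tw \<in> Arr" "dom tw = 1" "cod tw = 1"
  "phi \<in> Arr" "dom phi = 1" "cod phi = 1"
  by (simp_all add: pl_def ps_def pr_def tw_def phi_def)

lemma at_pl: "at pl i x = P i (D i x)"
  by (simp add: pl_def at_expand)

lemma at_ps: "at ps i x = P i (S i x)"
  by (simp add: ps_def at_expand)

lemma at_pr: "at pr i x = at ps (Suc i) (D i x)"
  by (simp add: pr_def at_expand)

lemma at_tw: "at tw i x = S i (at pl i x)"
  by (simp add: tw_def pl_def at_expand at_shift)

lemma at_phi: "at phi i x = at pl i (at pr i x)"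
  by (simp add: phi_def pl_def pr_def at_expand at_shift)

lemmas C_rules' = C_rules C_counit[of p] C_unit[of q] C_counit[of ps] C_endo[of pl] C_endo[of pr]
  C_endo[of tw] C_endo[of phi]
text \<open>Unlike counits, occurrences of delta are moved outward: the coproducts then stand next
  to each other and coassociativity applies.\<close>

lemmas shift_p = at_shift[of p p] at_shift'[of p m] at_shift[of m p] at_shift'[of p d] at_shift[of d p]
  at_shift'[of p s] at_shift[of s p] at_shift'[of p u] at_shift[of u p] at_shift'[of p q] at_shift[of q p]
  at_shift'[of p "br p' q'" for p' q'] at_shift[of "br p' q'" p for p' q']
lemmas shift_ps = at_shift[of ps ps] at_shift'[of ps m] at_shift[of m ps] at_shift'[of ps d] at_shift[of d ps]
  at_shift'[of ps s] at_shift[of s ps] at_shift'[of ps u] at_shift[of u ps] at_shift'[of ps q] at_shift[of q ps]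
  at_shift'[of ps "br p' q'" for p' q'] at_shift[of "br p' q'" ps for p' q']

text \<open>Both \<open>d\<close> and delta are multiplicative, and the crossing that
  \<open>d_m\<close> introduces vanishes because delta ends one of its strands.\<close>

lemma pl_m: "at pl i (M i x) = M i (at pl i (at pl (Suc i) x))"
proof -
  have *: "P i (P i (C (Suc i) y)) = P i (P (Suc (Suc i)) y)" for y
    using at_shift[of p p i "Suc i" "C (Suc i) y"] by (simp add: C_counit)
  have "at pl i (M i x) = M i (P i (P i (C (Suc i) (D i (D (Suc i) x)))))"
    by (simp add: at_pl at_d_m at_p_m at_shift[of p m])
  then show ?thesis
    by (simp add: * at_pl at_shift'[of d p])
qed

text \<open>S reverses products, but both values lie in the unit object, so naturality removes the
  crossing.\<close>

lemma ps_m: "at ps i (M i x) = at ps i (at ps i x)"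
proof -
  have "at ps i (M i x) = P i (P i (S i (S (Suc i) (C i x))))"
    by (simp add: at_ps antipode_mul at_p_m)
  also have "\<dots> = at ps i (at ps i (C i x))"
    by (simp add: at_ps shift_p at_shift[of s s])
  finally show ?thesis by (simp add: C_rules' shift_ps)
qed

lemma pr_m: "at pr i (M i x) = M i (at pr i (at pr (Suc i) x))"
  by (simp add: at_pr at_d_m ps_m C_rules' at_shift'[of m ps] at_shift'[of ps ps] at_shift'[of d ps])

lemma phi_m: "at phi i (M i x) = M i (at phi i (at phi (Suc i) x))"
  by (simp add: at_phi pl_m pr_m at_shift)

lemma pl_d: "at pl i (D i x) = D i (at pl i x)"
  by (simp add: at_pl shift_p at_d_coassoc)

text \<open>S reverses the coproduct and so exchanges the two sides on which delta is
  evaluated.\<close>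

lemma pl_s: "at pl i (S i x) = S i (at pr i x)"
proof -
  have "at pl i (S i x) = P (Suc i) (S i (S (Suc i) (D i x)))"
    by (simp only: at_pl antipode_comul) (simp only: C_counit pair_typed)
  then show ?thesis by (simp add: at_pr at_ps shift_p at_shift[of s s])
qed

lemma e_pl: "E i (at pl i x) = P i x"
proof -
  have "E i (at pl i x) = P i (E (Suc i) (D i x))"
    by (simp add: at_pl at_shift[of p e])
  then show ?thesis by (simp add: hopf_rules)
qed

lemma p_pl: "P i (at pl (Suc i) x) = at pl i (P i x)"
  by (simp add: at_shift)

text \<open>delta S is a left convolution inverse of delta: as delta is multiplicative, the antipode
  axiom applies under it.\<close>

lemma ps_p_d: "at ps i (P (Suc i) (D i x)) = E i x"
proof -
  have "at ps i (P (Suc i) (D i x)) = P i (M i (S i (D i x)))"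
    by (simp add: at_ps at_p_m shift_p)
  then show ?thesis by (simp add: hopf_rules at_p_u)
qed

text \<open>Between the two halves stand delta(S h2) and delta(h3), which cancel by
  \<open>ps_p_d\<close>.\<close>

lemma pr_pl_d: "at pr i (at pl (Suc i) (D i x)) = D i x"
proof -
  have "at pr i (at pl (Suc i) (D i x)) = at ps (Suc i) (P (Suc (Suc i)) (D (Suc i) (D (Suc i) (D i x))))"
    by (simp add: at_pr at_pl shift_p at_d_coassoc at_shift[of d d])
  then show ?thesis by (simp add: ps_p_d at_d_counit)
qed

text \<open>With phi read as \<open>pl\<close> after \<open>pr\<close>, the \<open>pr\<close>
  cancels the \<open>pl\<close> on the second half and the remaining \<open>pl\<close> passes to
  before the coproduct. This is the one-factor core of \<open>phi_lam\<close>.\<close>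

lemma phi_pl_d: "at phi i (at pl (Suc i) (D i x)) = D i (at pl i x)"
  by (simp add: at_phi pr_pl_d pl_d)

text \<open>Twisted form of \<open>antipode_cancel\<close>: \<open>pl\<close> is multiplicative and
  commutes with the coproduct on its first half, so it can be applied to h and a beforehand, and the
  counit of pl(h) is delta(h).\<close>

lemma tw_cancel: "M i (at tw i (M i (C (Suc i) (D i x)))) = at tw i (P i x)"
proof -
  have "M i (at tw i (M i (C (Suc i) (D i x)))) = M i (S i (M i (at pl i (C (Suc i) (at pl (Suc (Suc i)) (D i x))))))"
    by (simp add: at_tw pl_m C_rules')
  also have "\<dots> = M i (S i (M i (C (Suc i) (D i (at pl i (at pl (Suc i) x))))))"
    by (simp add: at_shift[of pl "br p' q'" for p' q'] at_shift'[of d pl] pl_d)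
  also have "\<dots> = at tw i (P i x)"
    by (simp add: antipode_cancel e_pl p_pl at_tw)
  finally show ?thesis .
qed

section \<open>The key relation and its passage through phi\<close>

text \<open>
  In Sweedler notation \<open>ww\<close> sends \<open>a \<otimes> b\<close> to \<open>tw(a) b\<^sub>1 \<otimes> b\<^sub>2\<close>.
\<close>

definition "ww = (m \<oplus> idn 1) \<diamondop> (tw \<oplus> idn 2) \<diamondop> (idn 1 \<oplus> d)"

lemma ww_typed [simp]: "ww \<in> Arr" "dom ww = 2" "cod ww = 2"
  by (simp_all add: ww_def)

lemma at_ww: "at ww i x = M i (at tw i (D (Suc i) x))"
  by (simp add: ww_def at_expand)

text \<open>For h acting on a \<otimes> b \<otimes> v, the coproduct of the second factor places h2
  right behind S~(h1 a), where \<open>tw_cancel\<close> applies. The delta it leaves is stored as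
  \<open>pl\<close> on the copy of h that still acts on b2 \<otimes> v.\<close>

lemma ww_lam: "at ww i (L (Suc (Suc n)) i x) = L (Suc n) (Suc i) (C i (at pl i (at ww (Suc i) x)))"
proof -
  have "at ww i (L (Suc (Suc n)) i x) = M i (at tw i (M i (L (Suc (Suc n)) (Suc (Suc i))
      (D (Suc (Suc (Suc i))) (C (Suc i) (D i x))))))"
    by (simp add: at_ww at_lam_Suc[of "Suc n" i] at_shift'[of m d] comul_lam)
  also have "\<dots> = L (Suc n) (Suc i) (M i (M i (at tw i (M i (C (Suc i) (C (Suc (Suc (Suc i)))
      (C (Suc (Suc i)) (D i (D i (D (Suc (Suc i)) x))))))))))"
    by (simp add: at_lam_Suc[of "Suc n" "Suc (Suc i)"] at_shift C_rules' at_d_coassoc at_m_assoc)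
  also have "\<dots> = L (Suc n) (Suc i) (M i (M i (at tw i (M i (C (Suc i) (D i (C (Suc (Suc i))
      (C (Suc i) (D i (D (Suc (Suc i)) x))))))))))"
    by (simp add: at_shift)
  also have "\<dots> = L (Suc n) (Suc i) (M i (at tw i (P i (C (Suc (Suc i)) (C (Suc i) (D i (D (Suc (Suc i)) x)))))))"
    by (simp only: tw_cancel)
  also have "\<dots> = L (Suc n) (Suc i) (M i (at tw i (C (Suc i) (C i (at pl i (D (Suc (Suc i)) x))))))"
    by (simp add: at_pl shift_p)
  also have "\<dots> = L (Suc n) (Suc i) (C i (at pl i (at ww (Suc i) x)))"
    by (simp add: at_ww at_shift C_rules')
  finally show ?thesis .
qed

text \<open>Carries the \<open>pl\<close> left by \<open>ww_lam\<close> from the half h2 back to h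
  itself, through the copies of phi already present. Factor by factor this is \<open>phi_m\<close>
  together with \<open>phi_pl_d\<close>.\<close>

lemma phi_lam:
  "at (tpow phi n) i (L n i (Br (Suc 0) n (Suc i) (at pl (Suc i) (D i x)))) =
    L n i (Br (Suc 0) n (Suc i) (D i (at pl i (at (tpow phi n) (Suc i) x))))"
proof (induction n arbitrary: i x)
  case 0
  then show ?case
    by (simp add: p_pl hopf_rules at_shift)
next
  case (Suc n)
  let ?T = "at (tpow phi n)"
  have "at (tpow phi (Suc n)) i (L (Suc n) i (Br (Suc 0) (Suc n) (Suc i) (at pl (Suc i) (D i x)))) =
      at phi i (M i (?T (Suc (Suc i)) (L n (Suc (Suc i)) (Br (Suc 0) n (Suc (Suc (Suc i)))
        (at pl (Suc (Suc (Suc i))) (D (Suc (Suc i)) (C (Suc i) (D i x))))))))"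
    by (simp add: at_lam_Suc at_tpow_Suc(1) at_br_Suc_right[of n] at_shift C_rules' at_d_coassoc)
  also have "\<dots> = M i (L n (Suc (Suc i)) (Br (Suc 0) n (Suc (Suc (Suc i))) (D (Suc (Suc i)) 
      (at phi i (at phi (Suc i) (at pl (Suc (Suc i)) (?T (Suc (Suc (Suc i))) (C (Suc i) (D i x)))))))))"
    by (simp add: Suc.IH phi_m at_shift)
  also have "\<dots> = M i (L n (Suc (Suc i)) (Br (Suc 0) n (Suc (Suc (Suc i))) (D (Suc (Suc i)) 
      (C (Suc i) (D i (at pl i (at (tpow phi (Suc n)) (Suc i) x)))))))"
  proof -
    have *: "at phi i (at phi (Suc i) (at pl (Suc (Suc i)) (C (Suc i) y))) =
        C (Suc i) (at phi i (at pl (Suc i) (at phi (Suc (Suc i)) y)))" for y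
      by (simp add: at_shift C_rules')
    have **: "?T (Suc (Suc (Suc i))) (C (Suc i) (D i x)) = C (Suc i) (D i (?T (Suc (Suc i)) x))"
      by (simp add: at_shift)
    have "at phi (Suc (Suc i)) (D i y) = D i (at phi (Suc i) y)" for y
      by (simp add: at_shift)
    then show ?thesis
      by (simp only: * ** phi_pl_d) (simp add: at_tpow_Suc(1))
  qed
  also have "\<dots> = L (Suc n) i (Br (Suc 0) (Suc n) (Suc i) (D i (at pl i (at (tpow phi (Suc n)) (Suc i) x))))"
    by (simp add: at_lam_Suc at_br_Suc_right[of n] at_shift C_rules' at_d_coassoc)
  finally show ?case .
qed

section \<open>Multiplication by sigma\<close>

text \<open>
  With \<open>\<sigma>\<close> written \<open>q\<close>: \<open>rq\<close> is the paper's \<open>R\<^sub>\<sigma>\<close>, \<open>lq\<close> is left multiplication by \<open>S \<sigma>\<close>, and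
  \<open>adq\<close> is \<open>ad\<^sub>\<sigma>\<close>.
\<close>

definition "rq = m \<diamondop> (idn 1 \<oplus> q)"
definition "sq = s \<diamondop> q"
definition "lq = m \<diamondop> (sq \<oplus> idn 1)"
definition "adq = m \<diamondop> (m \<oplus> idn 1) \<diamondop> (sq \<oplus> idn 1 \<oplus> q)"

lemma op_typed [simp]:
  "rq \<in> Arr" "dom rq = 1" "cod rq = 1" "sq \<in> Arr" "dom sq = 0" "cod sq = 1"
  "lq \<in> Arr" "dom lq = 1" "cod lq = 1" "adq \<in> Arr" "dom adq = 1" "cod adq = 1"
  by (simp_all add: rq_def sq_def lq_def adq_def)

lemma at_rq: "at rq i x = M i (Q (Suc i) x)"
  by (simp add: rq_def at_expand)

lemma at_sq: "at sq i x = S i (Q i x)"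
  by (simp add: sq_def at_expand)

lemma at_lq: "at lq i x = M i (at sq i x)"
  by (simp add: lq_def at_expand)

lemma at_adq: "at adq i x = at rq i (at lq i x)"
  by (simp add: adq_def at_lq at_rq at_expand at_shift[of sq q] at_shift[of m q])

text \<open>The crossing from \<open>antipode_comul\<close> meets two strands that start in the unit
  object, so one of them slides through it and S sigma is again group-like.\<close>

lemma d_sq: "D i (at sq i x) = at sq i (at sq i x)"
proof -
  have "D i (at sq i x) = C i (at sq i (at sq i x))"
    by (simp add: at_sq antipode_comul at_d_q at_shift'[of q s])
  also have "\<dots> = at sq (Suc i) (at sq i x)"
    by (simp add: C_unit)
  finally show ?thesis by (simp add: at_shift'[of sq sq])
qed

lemma e_sq: "E i (at sq i x) = x"
  by (simp add: at_sq counit_antipode at_e_q)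

lemma lam_sq: "L n i (at sq i x) = at (tpow lq n) i x"
proof (induction n arbitrary: i x)
  case 0
  then show ?case by (simp add: e_sq)
next
  case (Suc n)
  have "L (Suc n) i (at sq i x) = M i (L n (Suc (Suc i)) (C (Suc i) (at sq (Suc i) (at sq i x))))"
    by (simp add: at_lam_Suc d_sq at_shift[of sq sq])
  also have "\<dots> = M i (L n (Suc (Suc i)) (at sq (Suc (Suc i)) (at sq i x)))"
    by (simp add: C_unit)
  also have "\<dots> = at lq i (L n (Suc i) (at sq (Suc i) x))"
    by (simp add: at_lq at_shift[of sq])
  finally show ?case by (simp add: Suc.IH at_tpow_Suc(1))
qed

text \<open>Reading sigma as R_sigma of the unit allows the inserted sigma to be exchanged for
  \<open>u\<close>, with R_sigma carried out through the action; hence the \<open>u\<close> in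
  \<open>cyc0\<close>.\<close>

lemma q_rq: "Q i x = at rq i (U i x)"
  by (simp add: at_rq at_shift' at_m_unit)

lemma m_rq: "M i (at rq (Suc i) x) = at rq i (M i x)"
  by (simp add: at_rq at_m_assoc at_shift[of m q])

text \<open>Left multiplications commute with right multiplication by sigma. The position drops by
  one because the acting factor is used up.\<close>

lemma lam_rq: "k < n \<Longrightarrow> L n i (at rq (Suc (i + k)) x) = at rq (i + k) (L n i x)"
proof (induction n arbitrary: i k x)
  case (Suc n)
  show ?case
  proof (cases k)
    case 0
    have "L (Suc n) i (at rq (Suc i) x) = M i (L n (Suc (Suc i)) (at rq (Suc i) (C (Suc i) (D i x))))"
      by (simp add: at_lam_Suc at_shift[of d rq] C_endo[of rq])
    then show ?thesis
      by (simp add: 0 at_lam_Suc m_rq at_shift'[of rq "lam n"])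
  next
    case (Suc l)
    have "L (Suc n) i (at rq (Suc (i + k)) x) = M i (L n (Suc (Suc i)) (at rq (Suc (Suc (Suc i) + l)) (C (Suc i) (D i x))))"
      by (simp add: Suc at_lam_Suc at_shift[of _ rq])
    then show ?thesis
      using Suc Suc.prems Suc.IH[of l "Suc (Suc i)"] by (simp add: at_lam_Suc at_shift[of m rq])
  qed
qed simp

lemma s_rq: "S i (at rq i x) = at lq i (S i x)"
  by (simp add: at_rq at_lq at_sq antipode_mul C_rules' at_shift'[of q s])

lemma pr_pl: "at pr i (at pl i x) = at phi i x"
  by (simp add: at_phi) (simp add: at_pl at_pr shift_ps at_shift'[of p ps] at_d_coassoc at_shift'[of p d])

text \<open>S turns the outer \<open>pl\<close> into \<open>pr\<close>, which joins the
  \<open>pl\<close> inside \<open>tw\<close> to form phi. Each further copy of phi in the powers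
  arises here.\<close>

lemma pl_tw: "at pl i (at tw i x) = S i (at phi i x)"
  by (simp add: at_tw pl_s pr_pl)

lemma pl_q: "at pl i (Q i x) = Q i x"
  by (simp add: at_pl at_d_q at_p_q)

subsection \<open>Powers of the cyclic operator\<close>

definition "cyc n = (if n = 0 then idn 0 else lam n \<diamondop> (tw \<oplus> idn (n - 1) \<oplus> q))"
definition "cyc0 n = (if n = 0 then idn 0 else lam n \<diamondop> (s \<oplus> idn (n - 1) \<oplus> u))"

lemma cyc_typed [simp]: "cyc n \<in> Arr" "dom (cyc n) = n" "cod (cyc n) = n"
  "cyc0 n \<in> Arr" "dom (cyc0 n) = n" "cod (cyc0 n) = n"
  by (simp_all add: cyc_def cyc0_def)

lemma at_cyc: "at (cyc (Suc n)) i x = L (Suc n) i (at tw i (Q (Suc (i + n)) x))"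
  by (simp add: cyc_def at_expand)

lemma at_cyc0: "at (cyc0 (Suc n)) i x = L (Suc n) i (S i (U (Suc (i + n)) x))"
  by (simp add: cyc0_def at_expand)

lemma lam_1: "L (Suc 0) i x = M i x"
  by (simp add: at_lam_Suc C_counit hopf_rules)

abbreviation "T \<equiv> at (cyc (Suc 0))"

lemma at_T: "T i x = at rq i (at tw i x)"
  by (simp add: at_cyc lam_1 at_rq at_shift[of tw q])

text \<open>The R_sigma between the two copies of S~ becomes left multiplication by S sigma, since S
  reverses products and \<open>pl\<close> fixes sigma by delta sigma = id. With the outer R_sigma it
  gives \<open>adq\<close>.\<close>

lemma T_T: "T i (T i x) = at adq i (S i (S i (at phi i x)))"
proof -
  have *: "at tw i (at rq i y) = at lq i (at tw i y)" for y
    by (simp add: at_tw s_rq[symmetric]) (simp add: at_rq pl_m pl_q at_shift[of pl q])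
  show ?thesis
    by (simp add: at_T * at_adq) (simp add: at_tw pl_s pr_pl)
qed

lemma ww_q: "at ww i (Q (Suc i) x) = Q (Suc i) (T i x)"
  by (simp add: at_ww at_T at_d_q at_rq at_shift[of tw q] at_shift[of q q] at_shift[of m q])

lemma lam_s_q: "L (Suc n) i (S i (Q (Suc (i + n)) x)) = at rq (i + n) (at (cyc0 (Suc n)) i x)"
  by (simp add: q_rq at_cyc0 at_shift[of s rq] lam_rq)

lemma cyc0_rq:
  assumes "Suc k < n"
  shows "at (cyc0 n) i (at rq (Suc (i + k)) x) = at rq (i + k) (at (cyc0 n) i x)"
  using assms lam_rq[of k n i]
  by (cases n) (simp_all add: at_cyc0 at_shift'[of rq u] at_shift[of s rq])

lemma cyc0_rq_0: "at (cyc0 (Suc n)) i (at rq i x) = at (tpow lq (Suc n)) i (at (cyc0 (Suc n)) i x)"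
proof -
  have "at (cyc0 (Suc n)) i (at rq i x) = L (Suc n) i (M i (at sq i (S i (U (Suc (i + n)) x))))"
    by (simp add: at_cyc0 at_shift'[of rq u] s_rq at_lq)
  also have "\<dots> = L (Suc n) i (at sq i (L (Suc n) i (S i (U (Suc (i + n)) x))))"
    by (simp add: lam_mul[symmetric] at_shift'[of sq "lam (Suc n)"])
  finally show ?thesis
    by (simp add: lam_sq at_cyc0)
qed

text \<open>Naturality for an arrow on an initial part of the crossing block, padded by identities
  to the whole block.\<close>

lemma br_left_natural:
  assumes "f \<in> Arr" "dom f \<le> a"
  shows "at (br (a - dom f + cod f) n) i (at f i x) = at f (i + n) (at (br a n) i x)"
  using assms at_br_left[of "f \<oplus> idn (a - dom f)" n i x]
  by (simp add: at_expand add.commute)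

lemma br_right_natural:
  assumes "f \<in> Arr" "dom f \<le> a"
  shows "at (br n (a - dom f + cod f)) i (at f (i + n) x) = at f i (at (br n a) i x)"
  using assms at_br_right[of "f \<oplus> idn (a - dom f)" n i x]
  by (simp add: at_expand add.commute)

lemma br_q: "Br (Suc 0) (Suc n) 0 (Q (Suc n) x) = Q n (Br (Suc 0) n 0 x)"
proof -
  have "Br (Suc 0) n 0 (Q (Suc n) x) = Q (Suc n) (Br (Suc 0) n 0 x)"
    by (simp add: at_shift[of _ q])
  then show ?thesis
    by (simp add: at_br_Suc_right'[of n] C_unit)
qed

text \<open>The core of the inductive step, without sigma and the antipode: an acting element is
  moved out through \<open>ww\<close>, the copies of phi and the braiding.\<close>

lemma ww_tpow_br_lam:
  defines "W a x \<equiv> Br a (Suc 0) 0 (at (tpow phi a) 0 (at ww a x))"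
  shows "W a (L (a + Suc (Suc k)) 0 x) =
    L (a + Suc k) (Suc 0) (Br (Suc a) (Suc 0) 0 (at pl 0 (at (tpow phi a) (Suc 0) (at ww (Suc a) x))))"
proof -
  let ?z = "at pl 0 (at (tpow phi a) (Suc 0) (at ww (Suc a) x))"
  \<comment> \<open>Cutting the action after \<open>a\<close> factors leaves \<open>ww\<close> at
    the head of the second block, where \<open>ww_lam\<close> applies.\<close>
  have 1: "at ww a (L (a + Suc (Suc k)) 0 x) = L a 0 (at ww (Suc a) (L (Suc (Suc k)) (Suc a) (Br (Suc 0) a (Suc 0) (D 0 x))))"
    by (simp only: lam_add) (simp add: at_shift'[of "lam a" ww])
  also have "\<dots> = L a 0 (L (Suc k) (Suc (Suc a)) (C (Suc a) (Br (Suc 0) a (Suc 0) (at pl (Suc 0) (D 0 (at ww (Suc a) x))))))"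
    using at_br_left[of pl a "Suc 0"]
    by (simp add: ww_lam at_shift'[of "br (Suc 0) a" ww] at_shift'[of d ww])
  finally have "at (tpow phi a) 0 (at ww a (L (a + Suc (Suc k)) 0 x)) =
    L (Suc k) (Suc a) (C a (at (tpow phi a) 0 (L a 0 (Br (Suc 0) a (Suc 0) (at pl (Suc 0) (D 0 (at ww (Suc a) x)))))))"
    by (simp add: at_shift[of "lam a"] at_shift[of "tpow phi a"])
  also have "\<dots> = L (Suc k) (Suc a) (C a (L a 0 (Br (Suc 0) a (Suc 0) (D 0 ?z))))"
    by (simp only: phi_lam)
  also have "\<dots> = L (Suc k) (Suc a) (L a 0 (C (Suc a) (Br (Suc 0) a (Suc 0) (D 0 ?z))))"
    by (simp add: at_shift'[of "lam a" "br (Suc 0) (Suc 0)"])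
  finally have "W a (L (a + Suc (Suc k)) 0 x) =
      L (Suc k) (Suc a) (Br a (Suc 0) 0 (L a 0 (C (Suc a) (Br (Suc 0) a (Suc 0) (D 0 ?z)))))"
    by (simp add: W_def at_shift[of "br a (Suc 0)" "lam (Suc k)"])
  also have "\<dots> = L (Suc k) (Suc a) (L a (Suc 0) (Br (Suc (Suc a)) (Suc 0) 0 (Br (Suc 0) a (Suc 0) (D 0 ?z))))"
    using at_br_left[of "lam a" "Suc 0" 0] at_br_Suc_left'[of "Suc a" 0] by simp
  also have "\<dots> = L (Suc k) (Suc a) (L a (Suc 0) (Br (Suc 0) a (Suc (Suc 0)) (D (Suc 0) (Br (Suc a) (Suc 0) 0 ?z))))"
    using br_left_natural[of "idn 1 \<oplus> br (Suc 0) a" "Suc (Suc a)" "Suc 0" 0]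
      br_left_natural[of d "Suc a" "Suc 0" 0]
    by (simp add: at_expand)
  \<comment> \<open>The acting element now stands before both blocks, so the two partial actions
    join again by \<open>lam_add\<close>.\<close>
  also have "\<dots> = L (a + Suc k) (Suc 0) (Br (Suc a) (Suc 0) 0 ?z)"
    by (simp only: lam_add) (simp add: at_shift'[of "lam a" "lam (Suc k)"])
  finally show ?thesis .
qed

text \<open>
  \<open>ff n a\<close> collects the factors of statement (1) for \<open>k = a + 2\<close> to the right of \<open>\<tau>\<^sub>1\<close>.  The induction
  on \<open>k\<close> amounts to pulling one more cyclic operator through \<open>ff n a\<close>, which turns it into
  \<open>ff n (a + 1)\<close>.
\<close>

definition "ff n a x = Br (Suc 0) (n - 1) 0 (Br a (Suc 0) 0 (at (tpow phi a) 0 (at ww a x)))"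

text \<open>The \<open>pl\<close> delivered by \<open>ww_tpow_br_lam\<close> meets the
  \<open>tw\<close> of the absorbed operator and becomes a new phi under S. Admitting
  \<open>k = 0\<close> serves both continuations: sigma, in position \<open>n\<close>, lies beyond
  the strands of \<open>at ww (Suc a)\<close> if \<open>k > 0\<close> and is its second argument if
  \<open>k = 0\<close>.\<close>

lemma ff_cyc:
  assumes n: "n = a + Suc (Suc k)"
  shows "ff n a (at (cyc n) 0 x) = L (n - 1) 0 (S 0 (Br (Suc 0) n 0 (Br (Suc a) (Suc 0) 0
    (at (tpow phi (Suc a)) 0 (at ww (Suc a) (Q n x))))))"
proof -
  let ?y = "at (tpow phi a) (Suc 0) (at ww (Suc a) (Q n x))"
  have cyc: "at (cyc n) 0 x = L (a + Suc (Suc k)) 0 (at tw 0 (Q n x))"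
    using at_cyc[of "Suc (a + k)" 0 x] by (simp add: n)
  have "ff n a (at (cyc n) 0 x) = Br (Suc 0) (a + Suc k) 0 (L (a + Suc k) (Suc 0) (Br (Suc a) (Suc 0) 0
      (at pl 0 (at (tpow phi a) (Suc 0) (at ww (Suc a) (at tw 0 (Q n x)))))))"
    by (simp only: cyc ff_def ww_tpow_br_lam) (simp add: n)
  also have "\<dots> = L (a + Suc k) 0 (Br (Suc 0) n 0 (Br (Suc a) (Suc 0) 0 (at pl 0 (at tw 0 ?y))))"
    using at_br_right[of "lam (a + Suc k)" "Suc 0" 0]
    by (simp add: n at_shift'[of tw])
  also have "\<dots> = L (a + Suc k) 0 (Br (Suc 0) n 0 (Br (Suc a) (Suc 0) 0 (S 0 (at phi 0 ?y))))"
    by (simp only: pl_tw)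
  also have "\<dots> = L (a + Suc k) 0 (S 0 (Br (Suc 0) n 0 (Br (Suc a) (Suc 0) 0 (at phi 0 ?y))))"
    using br_left_natural[of s "Suc a" "Suc 0" 0] br_right_natural[of s n "Suc 0" 0]
    by (simp add: n)
  finally show ?thesis
    by (simp add: n at_tpow_Suc(1))
qed

lemma ff_cyc_less:
  assumes n: "n = a + Suc (Suc (Suc k))"
  shows "ff n a (at (cyc n) 0 x) = at rq (n - 2) (at (cyc0 (n - 1)) 0 (ff n (Suc a) x))"
proof -
  define j where "j = Suc (a + k)"
  have nj: "n = Suc (Suc j)" by (simp add: n j_def)
  have "Br (Suc a) (Suc 0) 0 (at (tpow phi (Suc a)) 0 (at ww (Suc a) (Q n x))) =
      Q n (Br (Suc a) (Suc 0) 0 (at (tpow phi (Suc a)) 0 (at ww (Suc a) x)))"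
    by (simp add: n at_shift[of ww q] at_shift[of "tpow phi (Suc a)" q] at_shift[of "br (Suc a) (Suc 0)" q] add.commute)
  then show ?thesis
    using ff_cyc[OF n, of x] lam_s_q[of j 0] br_q[of "Suc j"]
    by (simp add: nj ff_def)
qed

text \<open>Here \<open>ww\<close> meets the inserted sigma, which splits as sigma \<otimes> sigma:
  one copy completes S~ to \<open>T\<close>, the other is passed on.\<close>

lemma ff_cyc_last:
  assumes n: "n = Suc (Suc a)"
  shows "ff n a (at (cyc n) 0 x) = at rq a (at (cyc0 (Suc a)) 0
    (Br (Suc 0) (Suc a) 0 (Br (Suc a) (Suc 0) 0 (at (tpow phi (Suc a)) 0 (T (Suc a) x)))))"
proof -
  have "Br (Suc a) (Suc 0) 0 (at (tpow phi (Suc a)) 0 (Q n y)) =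
      Q n (Br (Suc a) (Suc 0) 0 (at (tpow phi (Suc a)) 0 y))" for y
    by (simp add: n at_shift[of "tpow phi (Suc a)" q] at_shift[of "br (Suc a) (Suc 0)" q])
  moreover have "at ww (Suc a) (Q n x) = Q n (T (Suc a) x)"
    by (simp add: n ww_q)
  ultimately show ?thesis
    using ff_cyc[of n a 0 x] lam_s_q[of a 0] br_q[of "Suc a"] by (simp add: n)
qed

text \<open>S reverses the coproduct, so it is the first half of the leading factor that travels to
  the end. There it carries delta and meets sigma, which makes it exactly \<open>T\<close>; the
  other half acts on the rest through plain S.\<close>

lemma cyc_split: "at (cyc (Suc n)) 0 x = L n 0 (S 0 (T (Suc n) (Br (Suc 0) (Suc n) 0 (D 0 x))))"
proof -
  let ?y = "at pl 0 (Q (Suc n) x)"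
  have *: "Br (Suc 0) (Suc n) 0 (at f 0 y) = at f (Suc n) (Br (Suc 0) (Suc n) 0 y)"
    if "f \<in> Arr" "dom f = 1" "cod f = 1" for f y
    using at_br_left[of f "Suc n" 0 y] that by simp
  have s1: "Br (Suc 0) (Suc n) 0 (S (Suc 0) y) = S 0 (Br (Suc 0) (Suc n) 0 y)" for y
    using br_right_natural[of s "Suc n" "Suc 0" 0 y] by simp
  have "at (cyc (Suc n)) 0 x = L n 0 (M (Suc n) (Br (Suc 0) n (Suc 0) (D 0 (S 0 ?y))))"
    using lam_add[of n "Suc 0" 0] at_cyc[of n 0 x] by (simp add: lam_1 at_tw)
  also have "\<dots> = L n 0 (M (Suc n) (Br (Suc 0) (Suc n) 0 (S 0 (S (Suc 0) (at pl 0 (D 0 (Q (Suc n) x)))))))"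
    by (simp add: antipode_comul at_br_Suc_right[of n] pl_d)
  also have "\<dots> = L n 0 (M (Suc n) (S (Suc n) (S 0 (at pl (Suc n) (Br (Suc 0) (Suc n) 0 (D 0 (Q (Suc n) x)))))))"
    by (simp add: * s1)
  also have "\<dots> = L n 0 (M (Suc n) (S (Suc n) (S 0 (at pl (Suc n) (Q (Suc (Suc n)) (Br (Suc 0) (Suc n) 0 (D 0 x)))))))"
    by (simp add: at_shift[of _ q])
  also have "\<dots> = L n 0 (S 0 (T (Suc n) (Br (Suc 0) (Suc n) 0 (D 0 x))))"
    by (simp add: at_T at_tw at_rq at_shift[of s] at_shift[of pl q] at_shift[of m q])
  finally show ?thesis .
qed

lemma cyc_cyc:
  assumes n: "n = Suc (Suc k)"
  shows "at (cyc n) 0 (at (cyc n) 0 x) = at rq k (at (cyc0 (Suc k)) 0 (T (Suc k) (ff n 0 x)))"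
proof -
  let ?k = "Suc k" and ?y = "at tw 0 (Q (Suc (Suc k)) x)"
  \<comment> \<open>With h the value of S~ on the first factor and b the second factor,
    \<open>?w\<close> is h1 b1 \<otimes> h2 \<otimes> b2, where h2 has yet to act on everything from
    b2 on.\<close>
  let ?w = "M 0 (C (Suc 0) (D 0 (D (Suc 0) ?y)))"
  have T_out: "L ?k 0 (S 0 (T (Suc ?k) z)) = T ?k (L ?k 0 (S 0 z))" for z
    by (simp add: at_shift)
  have "D 0 (at (cyc n) 0 x) = L (Suc ?k) (Suc 0) ?w"
    by (simp add: n at_cyc comul_lam) (simp add: at_lam_Suc[of "Suc ?k"] at_lam_Suc[of "Suc (Suc k)"] at_shift'[of m])
  then have "at (cyc n) 0 (at (cyc n) 0 x) = T ?k (L ?k 0 (S 0 (Br (Suc 0) (Suc ?k) 0 (L (Suc ?k) (Suc 0) ?w))))"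
    by (simp add: n cyc_split[of "Suc k"] T_out)
  also have "Br (Suc 0) (Suc ?k) 0 (L (Suc ?k) (Suc 0) ?w) = L (Suc ?k) 0 (Br (Suc 0) (Suc (Suc ?k)) 0 ?w)"
    using at_br_right[of "lam (Suc ?k)" "Suc 0" 0 ?w] by simp
  \<comment> \<open>The antipode undoes the action of h2 and leaves only epsilon(h2), so that h1 b1
    becomes h b1, as in \<open>ww\<close>.\<close>
  also have "L ?k 0 (S 0 \<dots>) = L ?k 0 (S 0 (E 0 (Br (Suc 0) (Suc (Suc ?k)) 0 ?w)))"
    by (rule lam_antipode_lam)
  also have "E 0 (Br (Suc 0) (Suc (Suc ?k)) 0 ?w) = Br (Suc 0) (Suc ?k) 0 (E (Suc 0) ?w)"
    using br_right_natural[of e "Suc (Suc ?k)" "Suc 0" 0 ?w] by simp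
  also have "E (Suc 0) ?w = at ww 0 (Q (Suc ?k) x)"
    by (simp add: at_shift'[of m e] C_counit hopf_rules at_ww at_shift'[of tw d])
  also have "\<dots> = Q (Suc ?k) (at ww 0 x)"
    by (simp add: at_shift)
  also have "Br (Suc 0) (Suc ?k) 0 \<dots> = Q ?k (ff n 0 x)"
    by (simp only: br_q) (simp add: ff_def n)
  also have "L ?k 0 (S 0 \<dots>) = at rq k (at (cyc0 ?k) 0 (ff n 0 x))"
    using lam_s_q[of k 0] by simp
  also have "T ?k \<dots> = at rq k (at (cyc0 ?k) 0 (T ?k (ff n 0 x)))"
    by (simp add: at_shift'[of rq] at_shift'[of "cyc0 (Suc k)"])
  finally show ?thesis .
qed

lemma T_out:
  assumes "f \<in> Arr" "dom f = a" "cod f = a"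
  shows "T a (at f 0 x) = at f 0 (T a x)"
  using assms by (simp add: at_shift')

lemma cyc0_pow_rq:
  assumes "a + b < n"
  shows "(at (cyc0 n) 0 ^^ a) (at rq (a + b) x) = at rq b ((at (cyc0 n) 0 ^^ a) x)"
  using assms
proof (induction a arbitrary: b)
  case (Suc a)
  then show ?case
    using Suc.IH[of "Suc b"] cyc0_rq[of b n 0] by simp
qed simp

text \<open>The exponent is \<open>a + 2\<close>, and \<open>k\<close> counts the leading factors
  not yet reached by R_sigma. A power is peeled off on the inside, where \<open>ff\<close> absorbs
  it; the R_sigma so produced on factor \<open>N\<close> passes the other \<open>a + 1\<close>
  copies of \<open>cyc0\<close> and lands just left of those already collected.\<close>

lemma cyc_pow:
  assumes "a + k = N"
  shows "(at (cyc (Suc (Suc N))) 0 ^^ Suc (Suc a)) x = at (tpow rq (Suc a)) k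
    ((at (cyc0 (Suc N)) 0 ^^ Suc a) (T (Suc N) (ff (Suc (Suc N)) a x)))"
  using assms
proof (induction a arbitrary: k x)
  case 0
  then show ?case
    by (simp add: cyc_cyc at_tpow_Suc(1) T_out del: funpow.simps) (simp add: cyc_cyc T_out at_tpow_Suc(1))
next
  case (Suc a)
  have "(at (cyc (Suc (Suc N))) 0 ^^ Suc (Suc (Suc a))) x =
      (at (cyc (Suc (Suc N))) 0 ^^ Suc (Suc a)) (at (cyc (Suc (Suc N))) 0 x)"
    by (simp only: funpow_Suc_right[of "Suc (Suc a)"] o_apply)
  also have "\<dots> = at (tpow rq (Suc a)) (Suc k) ((at (cyc0 (Suc N)) 0 ^^ Suc a) (T (Suc N)
      (at rq N (at (cyc0 (Suc N)) 0 (ff (Suc (Suc N)) (Suc a) x)))))"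
    using Suc.IH[of "Suc k"] ff_cyc_less[of "Suc (Suc N)" a k] Suc.prems by (simp del: funpow.simps)
  also have "\<dots> = at (tpow rq (Suc a)) (Suc k) ((at (cyc0 (Suc N)) 0 ^^ Suc a) (at rq N
      (at (cyc0 (Suc N)) 0 (T (Suc N) (ff (Suc (Suc N)) (Suc a) x)))))"
    by (simp add: at_shift'[of rq] T_out del: funpow.simps)
  also have "\<dots> = at (tpow rq (Suc a)) (Suc k) (at rq k ((at (cyc0 (Suc N)) 0 ^^ Suc a)
      (at (cyc0 (Suc N)) 0 (T (Suc N) (ff (Suc (Suc N)) (Suc a) x)))))"
    using cyc0_pow_rq[of "Suc a" k "Suc N"] Suc.prems by (simp del: funpow.simps)
  also have "\<dots> = at (tpow rq (Suc (Suc a))) k ((at (cyc0 (Suc N)) 0 ^^ Suc (Suc a))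
      (T (Suc N) (ff (Suc (Suc N)) (Suc a) x)))"
    by (simp add: at_tpow_Suc(1)[of rq "Suc a"] at_shift'[of rq] funpow_swap1)
  finally show ?case .
qed

lemma tpow_rq_lq: "at (tpow rq n) i (at (tpow lq n) i x) = at (tpow adq n) i x"
  by (induction n arbitrary: i) (simp_all add: at_tpow_Suc(1) at_adq at_shift'[of lq])

lemma cyc_pow_full:
  "(at (cyc (Suc (Suc n))) 0 ^^ Suc (Suc (Suc n))) x = at (tpow adq (Suc n)) 0
    ((at (cyc0 (Suc n)) 0 ^^ Suc (Suc n)) (at (tpow phi (Suc n)) 0 (T (Suc n) (T (Suc n)
      (Br (Suc 0) (Suc n) 0 (Br (Suc n) (Suc 0) 0 x))))))"
proof -
  let ?B = "\<lambda>x. Br (Suc 0) (Suc n) 0 (Br (Suc n) (Suc 0) 0 x)" and ?P = "at (tpow phi (Suc n)) 0"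
  have phi: "?B (?P y) = ?P (?B y)" for y
    using at_br_left[of "tpow phi (Suc n)" "Suc 0" 0] at_br_right[of "tpow phi (Suc n)" "Suc 0" 0]
    by simp
  have T: "?B (T (Suc n) y) = T (Suc n) (?B y)" for y
    using at_br_right[of "cyc (Suc 0)" "Suc n" 0] at_br_left[of "cyc (Suc 0)" "Suc n" 0] by simp
  \<comment> \<open>\<open>n\<close> applications bring R_sigma from factor \<open>n\<close> to
    factor 0; the remaining one turns it into left multiplication by S sigma on every
    factor.\<close>
  have rq: "(at (cyc0 (Suc n)) 0 ^^ Suc n) (at rq n y) =
      at (tpow lq (Suc n)) 0 ((at (cyc0 (Suc n)) 0 ^^ Suc n) y)" for y
    using cyc0_pow_rq[of n 0 "Suc n"] by (simp add: cyc0_rq_0)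
  have "(at (cyc (Suc (Suc n))) 0 ^^ Suc (Suc (Suc n))) x =
      (at (cyc (Suc (Suc n))) 0 ^^ Suc (Suc n)) (at (cyc (Suc (Suc n))) 0 x)"
    by (simp only: funpow_Suc_right[of "Suc (Suc n)"] o_apply)
  also have "\<dots> = at (tpow rq (Suc n)) 0 ((at (cyc0 (Suc n)) 0 ^^ Suc n) (T (Suc n)
      (at rq n (at (cyc0 (Suc n)) 0 (?B (?P (T (Suc n) x)))))))"
    using cyc_pow[of n 0 n] ff_cyc_last[of "Suc (Suc n)" n] by (simp del: funpow.simps)
  also have "\<dots> = at (tpow rq (Suc n)) 0 ((at (cyc0 (Suc n)) 0 ^^ Suc n)
      (at rq n (at (cyc0 (Suc n)) 0 (?P (T (Suc n) (T (Suc n) (?B x)))))))"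
    by (simp add: at_shift'[of rq "cyc (Suc 0)"] T_out phi T del: funpow.simps)
  also have "\<dots> = at (tpow adq (Suc n)) 0 ((at (cyc0 (Suc n)) 0 ^^ Suc (Suc n))
      (?P (T (Suc n) (T (Suc n) (?B x)))))"
    by (simp only: rq tpow_rq_lq) (simp add: funpow_swap1)
  finally show ?thesis .
qed

lemma cpow_cyc:
  assumes "2 \<le> n" "2 \<le> k" "k \<le> n"
  shows "cpow (cyc n) k =
    (idn (n - k) \<oplus> tpow rq (k - 1) \<oplus> idn 1) \<diamondop> (cpow (cyc0 (n - 1)) (k - 1) \<oplus> cyc 1) \<diamondop>
    br 1 (n - 1) \<diamondop> (br (k - 2) 1 \<oplus> idn (n - k + 1)) \<diamondop>
    (tpow phi (k - 2) \<oplus> (m \<diamondop> (tw \<oplus> idn 1)) \<oplus> idn (n - k + 1)) \<diamondop>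
    (idn (k - 1) \<oplus> d \<oplus> idn (n - k))"
proof -
  obtain a where k: "k = Suc (Suc a)" using assms(2) by (metis add_2_eq_Suc nat_le_iff_add)
  obtain b where n: "n = Suc (Suc (a + b))" using assms(3) k by (metis add_Suc nat_le_iff_add)
  have "at (cpow (cyc n) k) 0 x = at (tpow rq (Suc a)) b (at (cpow (cyc0 (n - 1)) (Suc a)) 0 (T (n - 1)
      (ff n a x)))" for x
    using cyc_pow[of a b "a + b" x] by (simp add: at_cpow n k del: funpow.simps)
  then show ?thesis
    by (intro at_eqD) (simp_all add: at_expand n k ff_def at_ww)
qed

lemma cpow_cyc_1: "cpow (cyc 1) 2 = adq \<diamondop> cpow s 2 \<diamondop> phi"
  by (intro at_eqD) (simp_all add: at_expand at_cpow T_T numeral_2_eq_2)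

lemma cpow_cyc_full:
  assumes "2 \<le> n"
  shows "cpow (cyc n) (n + 1) =
    ((tpow adq (n - 1) \<diamondop> cpow (cyc0 (n - 1)) n \<diamondop> tpow phi (n - 1)) \<oplus> cpow (cyc 1) 2) \<diamondop>
    br 1 (n - 1) \<diamondop> br (n - 1) 1"
proof -
  obtain a where n: "n = Suc (Suc a)" using assms by (metis add_2_eq_Suc nat_le_iff_add)
  show ?thesis
    unfolding n using cyc_pow_full[of a]
    by (intro at_eqD) (simp_all add: at_expand at_cpow numeral_2_eq_2 del: funpow.simps, simp_all)
qed

end

section \<open>Transfer to words in the tensor powers\<close>

locale hopf_in_braided = braided_monoidal_category B
  for B :: "('o, 'a, 'm) braided_data_scheme" (structure) +
  fixes H :: "('o, 'a) hopf_data" and \<delta> \<sigma> :: "('o, 'a) word_arr"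
  assumes hopf: "hopf_algebra_in B H"
    and pair: "modular_pair B H \<delta> \<sigma>"
begin

text \<open>Restricting to powers of the base object lets the length of a word determine the word,
  as objects that are numbers require.\<close>

definition "Arrs = {f. warr f \<and> wsrc f = hpow H (length (wsrc f)) \<and> wtrg f = hpow H (length (wtrg f))}"
definition "wdom f = length (wsrc f)"
definition "wcod f = length (wtrg f)"

lemma base_obj [simp]: "base H \<in> obj B"
  using hopf by (simp add: hopf_algebra_in_def algebra_in_def)

lemma hpow_obj: "objs (hpow H n)"
  by auto

lemma Arrs_iff: "f \<in> Arrs \<longleftrightarrow> warr f \<and> wsrc f = hpow H (wdom f) \<and> wtrg f = hpow H (wcod f)"
  by (simp add: Arrs_def wdom_def wcod_def)

lemma word_hom_Arrs: "f \<in> word_hom B (hpow H a) (hpow H b) \<longleftrightarrow> f \<in> Arrs \<and> wdom f = a \<and> wcod f = b"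
  unfolding word_hom_iff Arrs_def wdom_def wcod_def by auto

lemma wdom_simps [simp]: "wdom (hid B H n) = n" "wcod (hid B H n) = n"
  "wdom (g \<bullet> f) = wdom f" "wcod (g \<bullet> f) = wcod g"
  "wdom (f \<boxtimes> g) = wdom f + wdom g" "wcod (f \<boxtimes> g) = wcod f + wcod g"
  "wdom (wbraid B (hpow H a) (hpow H b)) = a + b" "wcod (wbraid B (hpow H a) (hpow H b)) = b + a"
  by (simp_all add: wdom_def wcod_def hpow_obj)

sublocale words: strict_monoidal_nat Arrs wdom wcod "wcmp B" "wtens B" "hid B H"
proof
  fix f g h f' g' m n
  show "hid B H n \<in> Arrs"
    by (simp add: Arrs_iff hpow_obj)
  show "wdom (hid B H n) = n" "wcod (hid B H n) = n" by simp_all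
  show "f \<bullet> g \<in> Arrs" "wdom (f \<bullet> g) = wdom g" "wcod (f \<bullet> g) = wcod f"
    if "g \<in> Arrs" "f \<in> Arrs" "wcod g = wdom f"
    using that by (simp_all add: Arrs_iff)
  show "f \<boxtimes> g \<in> Arrs" "wdom (f \<boxtimes> g) = wdom f + wdom g" "wcod (f \<boxtimes> g) = wcod f + wcod g"
    if "f \<in> Arrs" "g \<in> Arrs"
    using that by (simp_all add: Arrs_iff replicate_add)
  show "(h \<bullet> g) \<bullet> f = h \<bullet> g \<bullet> f"
    if "f \<in> Arrs" "g \<in> Arrs" "h \<in> Arrs" "wcod f = wdom g" "wcod g = wdom h"
    using that by (intro wcmp_assoc) (simp_all add: Arrs_iff)
  show "hid B H n \<bullet> f = f" if "f \<in> Arrs" "wcod f = n"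
    using that by (intro wid_left) (simp_all add: Arrs_iff)
  show "f \<bullet> hid B H n = f" if "f \<in> Arrs" "wdom f = n"
    using that by (intro wid_right) (simp_all add: Arrs_iff)
  show "(f \<boxtimes> g) \<boxtimes> h = f \<boxtimes> g \<boxtimes> h" if "f \<in> Arrs" "g \<in> Arrs" "h \<in> Arrs"
    using that by (intro wtens_assoc) (simp_all add: Arrs_iff)
  show "hid B H 0 \<boxtimes> f = f" "f \<boxtimes> hid B H 0 = f" if "f \<in> Arrs"
    using that by (simp_all add: Arrs_iff wtens_Nil_left wtens_Nil_right)
  show "hid B H m \<boxtimes> hid B H n = hid B H (m + n)"
    by (simp add: wtens_wid hpow_obj replicate_add)
  show "(g \<bullet> f) \<boxtimes> (g' \<bullet> f') = (g \<boxtimes> g') \<bullet> (f \<boxtimes> f')"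
    if "f \<in> Arrs" "g \<in> Arrs" "f' \<in> Arrs" "g' \<in> Arrs" "wcod f = wdom g" "wcod f' = wdom g'"
    using that by (intro wtens_wcmp) (simp_all add: Arrs_iff)
qed

lemma struct_Arrs:
  "mul H \<in> Arrs \<and> wdom (mul H) = 2 \<and> wcod (mul H) = 1"
  "unt H \<in> Arrs \<and> wdom (unt H) = 0 \<and> wcod (unt H) = 1"
  "comul H \<in> Arrs \<and> wdom (comul H) = 1 \<and> wcod (comul H) = 2"
  "cnt H \<in> Arrs \<and> wdom (cnt H) = 1 \<and> wcod (cnt H) = 0"
  "ant H \<in> Arrs \<and> wdom (ant H) = 1 \<and> wcod (ant H) = 1"
  "\<delta> \<in> Arrs \<and> wdom \<delta> = 1 \<and> wcod \<delta> = 0"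
  "\<sigma> \<in> Arrs \<and> wdom \<sigma> = 0 \<and> wcod \<sigma> = 1"
  unfolding word_hom_Arrs[symmetric] using hopf pair
  by (simp_all add: hopf_algebra_in_def algebra_in_def coalgebra_in_def modular_pair_def numeral_2_eq_2)

sublocale words: modular_nat Arrs wdom wcod "wcmp B" "wtens B" "hid B H"
  "\<lambda>p q. wbraid B (hpow H p) (hpow H q)" "unt H" "cnt H" "mul H" "comul H" "ant H" \<delta> \<sigma>
proof
  fix f g p q r n
  show "wbraid B (hpow H p) (hpow H q) \<in> Arrs"
    by (simp add: Arrs_iff replicate_add hpow_obj)
  show "wbraid B (hpow H (wcod f)) (hpow H (wcod g)) \<bullet> (f \<boxtimes> g) =
      (g \<boxtimes> f) \<bullet> wbraid B (hpow H (wdom f)) (hpow H (wdom g))" if "f \<in> Arrs" "g \<in> Arrs"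
    using that wbraid_natural[of f g] by (simp add: Arrs_iff)
  show "wbraid B (hpow H p) (hpow H (q + r)) = (hid B H q \<boxtimes> wbraid B (hpow H p) (hpow H r)) \<bullet>
      (wbraid B (hpow H p) (hpow H q) \<boxtimes> hid B H r)"
    by (simp add: replicate_add wbraid_append_right hpow_obj)
  show "wbraid B (hpow H (p + q)) (hpow H r) = (wbraid B (hpow H p) (hpow H r) \<boxtimes> hid B H q) \<bullet>
      (hid B H p \<boxtimes> wbraid B (hpow H q) (hpow H r))"
    by (simp add: replicate_add wbraid_append_left hpow_obj)
  show "wbraid B (hpow H 0) (hpow H n) = hid B H n" "wbraid B (hpow H n) (hpow H 0) = hid B H n"
    by (simp_all add: wbraid_Nil_left wbraid_Nil_right hpow_obj)
qed (use struct_Arrs hopf pair in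
    \<open>auto simp: hopf_algebra_in_def algebra_in_def coalgebra_in_def modular_pair_def\<close>)

lemma wpow_eq: "f \<in> Arrs \<Longrightarrow> wpow B f n = words.cpow f n"
  by (induction n) (simp_all add: Arrs_iff words.cpow.simps)

lemma wtpow_eq: "wtpow B f n = words.tpow f n"
  by (induction n) (simp_all add: words.tpow.simps)

lemma diag_action_eq: "diag_action B H n = words.lam n"
  by (induction n) (simp_all add: words.lam.simps)

lemma twisted_antipode_eq: "twisted_antipode B H \<delta> = words.tw"
  by (simp add: twisted_antipode_def words.tw_def)

lemma tau_eq: "tau B H \<delta> \<sigma> n = words.cyc n"
  by (simp add: tau_def words.cyc_def diag_action_eq twisted_antipode_eq)

lemma twisted_antipode_counit: "twisted_antipode B H (cnt H) = ant H"
proof -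
  have "cnt H \<boxtimes> ant H = ant H \<bullet> (cnt H \<boxtimes> hid B H 1)"
    using words.tns_split(2)[of "cnt H" "ant H"] words.tns_left[of "ant H"] struct_Arrs by simp
  then show ?thesis
    using struct_Arrs words.d_counit(1)
    by (simp add: twisted_antipode_def words.cmp_assoc words.idn_right del: replicate.simps)
qed

lemma tau_trivial_eq: "tau B H (cnt H) (unt H) n = words.cyc0 n"
  by (simp add: tau_def words.cyc0_def diag_action_eq twisted_antipode_counit)

lemma op_eq: "R_op B H \<sigma> = words.rq" "phi_op B H \<delta> = words.phi" "ad_op B H \<sigma> = words.adq"
  by (simp_all add: R_op_def words.rq_def phi_op_def words.phi_def words.ps_def ad_op_def
      words.adq_def words.sq_def)

lemmas to_words = tau_eq tau_trivial_eq op_eq wtpow_eq twisted_antipode_eq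

end

theorem theorem2:
  fixes B :: "('o, 'a) braided_data" (structure)
    and H :: "('o, 'a) hopf_data"
    and \<delta> \<sigma> :: "('o, 'a) word_arr"
  assumes "braided_monoidal_category B"
    and "hopf_algebra_in B H"
    and "modular_pair B H \<delta> \<sigma>"
  shows
    "(\<forall>n k. 2 \<le> n \<longrightarrow> 2 \<le> k \<longrightarrow> k \<le> n \<longrightarrow>
        wpow B (tau B H \<delta> \<sigma> n) k =
          (hid B H (n - k) \<boxtimes> wtpow B (R_op B H \<sigma>) (k - 1) \<boxtimes> hid B H 1)
          \<bullet> (wpow B (tau B H (cnt H) (unt H) (n - 1)) (k - 1) \<boxtimes> tau B H \<delta> \<sigma> 1)
          \<bullet> wbraid B (hpow H 1) (hpow H (n - 1))
          \<bullet> (wbraid B (hpow H (k - 2)) (hpow H 1) \<boxtimes> hid B H (n - k + 1))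
          \<bullet> (wtpow B (phi_op B H \<delta>) (k - 2)
               \<boxtimes> (mul H \<bullet> (twisted_antipode B H \<delta> \<boxtimes> hid B H 1))
               \<boxtimes> hid B H (n - k + 1))
          \<bullet> (hid B H (k - 1) \<boxtimes> comul H \<boxtimes> hid B H (n - k)))
     \<and> wpow B (tau B H \<delta> \<sigma> 1) 2 = ad_op B H \<sigma> \<bullet> wpow B (ant H) 2 \<bullet> phi_op B H \<delta>
     \<and> (\<forall>n. 2 \<le> n \<longrightarrow>
        wpow B (tau B H \<delta> \<sigma> n) (n + 1) =
          ((wtpow B (ad_op B H \<sigma>) (n - 1)
              \<bullet> wpow B (tau B H (cnt H) (unt H) (n - 1)) n
              \<bullet> wtpow B (phi_op B H \<delta>) (n - 1))
            \<boxtimes> wpow B (tau B H \<delta> \<sigma> 1) 2)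
          \<bullet> wbraid B (hpow H 1) (hpow H (n - 1))
          \<bullet> wbraid B (hpow H (n - 1)) (hpow H 1))"
proof -
  interpret hopf_in_braided B H \<delta> \<sigma>
    using assms by (intro hopf_in_braided.intro hopf_in_braided_axioms.intro)
  show ?thesis
    unfolding to_words
    using words.cpow_cyc words.cpow_cyc_1 words.cpow_cyc_full
    by (simp only: wpow_eq words.cyc_typed words.struct_typed) blast
qed

end
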